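(* Let $H$ be a Hilbert space, $\lambda \in \mathbb{R}$, and let $\Phi:H \rightarrow (-\infty,+\infty]$ be proper, $\lambda$-convex, and lower semicontinuous. Let $u$ be the unique gradient flow of $\Phi$ starting at $x_0 \in \overline{\operatorname{dom}(\Phi)}$. Define $\kappa: (0,+\infty) \times \mathbb{R} \to \mathbb{R}$ by $\kappa(t,s):= \frac{e^{2s t}-1}{2s}$ for $s\neq 0$ and $\kappa(t,0):=t$. Then, for all $t> 0$, $$ \Phi(u(t))\leq [\Phi]^{\kappa(t,\lambda)}(x_0).$$
   Context: $\operatorname{dom}(\Phi)=\{x:\Phi(x)\ne+\infty\}$; $\Phi$ is proper if $\operatorname{dom}(\Phi)\neq\emptyset$. Hilbert spaces are real with norm $\|\cdot\|$. $\Phi$ is $\lambda$-convex if $\Phi(tx+(1-t)y)\le t\Phi(x)+(1-t)\Phi(y)-\frac12\lambda t(1-t)\|x-y\|^2$ for all $x,y\in H$, $t\in[0,1]$. For $\gamma>0$ the Moreau envelope of $\Phi$ is $[\Phi]^\gamma(x):=\inf_{y\in H}\left(\Phi(y)+\frac1{2\gamma}\|y-x\|^2\right)$. The gradient flow of $\Phi$ (proper, $\lambda$-convex, lower semicontinuous) starting at $x_0\in\overline{\operatorname{dom}(\Phi)}$ is the (existing and unique) locally absolutely continuous curve $u:(0,+\infty)\to H$ with $u(t)\to x_0$ as $t\downarrow0$ such that for a.e. $t>0$ and all $v\in H$, $\frac12\frac{d}{dt}\|u(t)-v\|^2+\frac12\lambda\|u(t)-v\|^2+\Phi(u(t))\le\Phi(v)$.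 *)

theory Defs
  imports "HOL-Analysis.Analysis"
begin

text \<open>
  A functional \<open>\<Phi> : H \<rightarrow> (-\<infinity>, +\<infinity>]\<close> is an \<^typ>\<open>ereal\<close>-valued function; that it omits
  the value \<open>-\<infinity>\<close> is a separate hypothesis wherever it is needed. A real Hilbert space is a
  type of sort \<open>{real_inner, complete_space}\<close>.
\<close>

definition edom :: "('a \<Rightarrow> ereal) \<Rightarrow> 'a set" where
  "edom \<Phi> = {x. \<Phi> x \<noteq> \<infinity>}"

definition proper_fun :: "('a \<Rightarrow> ereal) \<Rightarrow> bool" where
  "proper_fun \<Phi> \<longleftrightarrow> edom \<Phi> \<noteq> {}"

definition lower_semicontinuous :: "('a::topological_space \<Rightarrow> ereal) \<Rightarrow> bool" where
  "lower_semicontinuous \<Phi> \<longleftrightarrow> (\<forall>x. \<Phi> x \<le> Liminf (at x) \<Phi>)"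

text \<open>
  At \<open>t = 0\<close> and \<open>t = 1\<close> the convention \<open>0 * \<infinity> = 0\<close> of \<^typ>\<open>ereal\<close> makes the inequality
  trivial, as it should be. No \<open>\<infinity> - \<infinity>\<close> occurs when \<open>\<Phi>\<close> omits \<open>-\<infinity>\<close>.
\<close>

definition lambda_convex :: "real \<Rightarrow> ('a::real_inner \<Rightarrow> ereal) \<Rightarrow> bool" where
  "lambda_convex l \<Phi> \<longleftrightarrow>
     (\<forall>x y. \<forall>t\<in>{0..1}.
        \<Phi> (t *\<^sub>R x + (1 - t) *\<^sub>R y)
          \<le> ereal t * \<Phi> x + ereal (1 - t) * \<Phi> y
             - ereal (1/2 * l * t * (1 - t) * (norm (x - y))\<^sup>2))"

definition moreau_envelope :: "('a::real_inner \<Rightarrow> ereal) \<Rightarrow> real \<Rightarrow> 'a \<Rightarrow> ereal" where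
  "moreau_envelope \<Phi> \<gamma> x = (INF y. \<Phi> y + ereal (1 / (2 * \<gamma>) * (norm (y - x))\<^sup>2))"

text \<open>
  The finite set \<open>D\<close> is a family of non-overlapping intervals, \<open>(c, d)\<close> being the pair of
  endpoints of \<open>{c..d}\<close>. (The library's \<^const>\<open>absolutely_continuous\<close> is about measures.)
\<close>

definition abs_continuous_on :: "real set \<Rightarrow> (real \<Rightarrow> 'a::metric_space) \<Rightarrow> bool" where
  "abs_continuous_on I u \<longleftrightarrow>
     (\<forall>\<epsilon>>0. \<exists>\<delta>>0. \<forall>D.
        finite D \<and>
        (\<forall>(c, d)\<in>D. c \<le> d \<and> {c..d} \<subseteq> I) \<and>
        pairwise (\<lambda>(c, d) (c', d'). {c<..<d} \<inter> {c'<..<d'} = {}) D \<and>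
        (\<Sum>(c, d)\<in>D. d - c) < \<delta>
        \<longrightarrow> (\<Sum>(c, d)\<in>D. dist (u c) (u d)) < \<epsilon>)"

text \<open>
  A curve on \<open>(0, +\<infinity>)\<close> is a function on \<^typ>\<open>real\<close> of which only the values at positive
  arguments matter.
\<close>

definition locally_abs_continuous :: "(real \<Rightarrow> 'a::metric_space) \<Rightarrow> bool" where
  "locally_abs_continuous u \<longleftrightarrow> (\<forall>a b. 0 < a \<and> a \<le> b \<longrightarrow> abs_continuous_on {a..b} u)"

text \<open>
  In the evolution variational inequality, \<open>D\<close> is the derivative of \<open>s \<mapsto> \<parallel>u(s) - v\<parallel>\<^sup>2\<close> at
  \<open>t\<close>; its existence is part of the requirement. The exceptional null set does not depend on
  \<open>v\<close>.
\<close>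

definition gradient_flow ::
  "real \<Rightarrow> ('a::real_inner \<Rightarrow> ereal) \<Rightarrow> 'a \<Rightarrow> (real \<Rightarrow> 'a) \<Rightarrow> bool" where
  "gradient_flow l \<Phi> x\<^sub>0 u \<longleftrightarrow>
     locally_abs_continuous u \<and>
     (u \<longlongrightarrow> x\<^sub>0) (at_right 0) \<and>
     (AE t in lborel. t > 0 \<longrightarrow>
        (\<forall>v. \<exists>D. ((\<lambda>s. (norm (u s - v))\<^sup>2) has_real_derivative D) (at t) \<and>
             ereal (1/2 * D + 1/2 * l * (norm (u t - v))\<^sup>2) + \<Phi> (u t) \<le> \<Phi> v))"

definition kappa :: "real \<Rightarrow> real \<Rightarrow> real" where
  "kappa t s = (if s = 0 then t else (exp (2 * s * t) - 1) / (2 * s))"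

end

theory Submission
  imports Defs
begin

text \<open>
  Put \<open>w = u t - v\<close>. Formally \<open>d/dt \<Phi>(u) = -\<parallel>u'\<parallel>\<^sup>2\<close>, and the evolution variational inequality
  reads \<open>\<Phi>(u) - \<Phi>(v) \<le> -\<langle>u', w\<rangle> - \<lambda>/2 \<parallel>w\<parallel>\<^sup>2\<close>. Hence \<open>\<kappa> (\<Phi>(u) - \<Phi>(v)) + g \<parallel>w\<parallel>\<^sup>2\<close> is nonincreasing,
  with \<open>g = 1/2\<close> if \<open>\<lambda> \<ge> 0\<close> and \<open>g = \<kappa>'/2\<close> if \<open>\<lambda> < 0\<close>; it starts from \<open>\<parallel>x\<^sub>0 - v\<parallel>\<^sup>2 / 2\<close>.

  The flow need not be strongly differentiable where the inequality holds, and \<open>\<Phi>(u)\<close> need not be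
  differentiable there. Monotonicity is therefore derived from one-sided Dini estimates at almost
  every time, for absolutely continuous functions; this is also how the contraction property is
  obtained, which makes \<open>u\<close> and \<open>\<Phi>(u)\<close> locally Lipschitz. At a good time \<open>t\<close> the inequality with
  \<open>v = u (t - k)\<close> gives \<open>\<Phi>(u t) - \<Phi>(u (t - k)) \<le> - k L(e\<^sub>k) + O(k\<^sup>2)\<close>, where \<open>L\<close> is the weak
  derivative and \<open>e\<^sub>k\<close> the backward difference quotient; nearly minimal elements of the convex hulls
  of the \<open>e\<^sub>k\<close> show that \<open>L(e\<^sub>k)\<close> is, for arbitrarily small \<open>k\<close>, almost as large as \<open>\<parallel>L\<parallel>\<^sup>2\<close>.
\<close>

section \<open>Absolutely continuous functions\<close>

text \<open>This isolates the conditions on a family of intervals that depend neither on the ambient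
  set nor on \<delta>, so that families can be shifted and enlarged separately from these
  bounds.\<close>

definition nonoverlapping :: "(real \<times> real) set \<Rightarrow> bool" where
  "nonoverlapping D \<longleftrightarrow>
     finite D \<and> (\<forall>(c, d)\<in>D. c \<le> d) \<and>
     pairwise (\<lambda>(c, d) (c', d'). {c<..<d} \<inter> {c'<..<d'} = {}) D"

lemma abs_continuous_onD:
  assumes "abs_continuous_on I u" "\<epsilon> > 0"
  obtains \<delta> where "\<delta> > 0"
    "\<And>D. nonoverlapping D \<Longrightarrow> (\<And>c d. (c, d) \<in> D \<Longrightarrow> {c..d} \<subseteq> I) \<Longrightarrow> (\<Sum>(c, d)\<in>D. d - c) < \<delta> \<Longrightarrow>
       (\<Sum>(c, d)\<in>D. dist (u c) (u d)) < \<epsilon>"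
proof -
  obtain \<delta> where \<delta>: "\<delta> > 0" "\<forall>D. finite D \<and>
        (\<forall>(c, d)\<in>D. c \<le> d \<and> {c..d} \<subseteq> I) \<and>
        pairwise (\<lambda>(c, d) (c', d'). {c<..<d} \<inter> {c'<..<d'} = {}) D \<and>
        (\<Sum>(c, d)\<in>D. d - c) < \<delta>
        \<longrightarrow> (\<Sum>(c, d)\<in>D. dist (u c) (u d)) < \<epsilon>"
    using assms unfolding abs_continuous_on_def by blast
  show ?thesis
  proof (rule that[OF \<delta>(1)])
    fix D assume D: "nonoverlapping D" "\<And>c d. (c, d) \<in> D \<Longrightarrow> {c..d} \<subseteq> I"
      "(\<Sum>(c, d)\<in>D. d - c) < \<delta>"
    show "(\<Sum>(c, d)\<in>D. dist (u c) (u d)) < \<epsilon>"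
      by (rule \<delta>(2)[rule_format]) (use D in \<open>auto simp: nonoverlapping_def\<close>)
  qed
qed

lemma abs_continuous_onI:
  assumes "\<And>\<epsilon>. \<epsilon> > 0 \<Longrightarrow> \<exists>\<delta>>0. \<forall>D. nonoverlapping D \<and> (\<forall>(c, d)\<in>D. {c..d} \<subseteq> I) \<and>
      (\<Sum>(c, d)\<in>D. d - c) < \<delta> \<longrightarrow> (\<Sum>(c, d)\<in>D. dist (u c) (u d)) < \<epsilon>"
  shows "abs_continuous_on I u"
  unfolding abs_continuous_on_def
proof (intro allI impI)
  fix \<epsilon> :: real assume "\<epsilon> > 0"
  from assms[OF this] obtain \<delta> where \<delta>: "\<delta> > 0" "\<forall>D. nonoverlapping D \<and> (\<forall>(c, d)\<in>D. {c..d} \<subseteq> I) \<and>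
      (\<Sum>(c, d)\<in>D. d - c) < \<delta> \<longrightarrow> (\<Sum>(c, d)\<in>D. dist (u c) (u d)) < \<epsilon>" by blast
  show "\<exists>\<delta>>0. \<forall>D. finite D \<and> (\<forall>(c, d)\<in>D. c \<le> d \<and> {c..d} \<subseteq> I) \<and>
        pairwise (\<lambda>(c, d) (c', d'). {c<..<d} \<inter> {c'<..<d'} = {}) D \<and>
        (\<Sum>(c, d)\<in>D. d - c) < \<delta> \<longrightarrow> (\<Sum>(c, d)\<in>D. dist (u c) (u d)) < \<epsilon>"
  proof (intro exI[of _ \<delta>] conjI allI impI)
    fix D assume D: "finite D \<and> (\<forall>(c, d)\<in>D. c \<le> d \<and> {c..d} \<subseteq> I) \<and>
        pairwise (\<lambda>(c, d) (c', d'). {c<..<d} \<inter> {c'<..<d'} = {}) D \<and>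
        (\<Sum>(c, d)\<in>D. d - c) < \<delta>"
    show "(\<Sum>(c, d)\<in>D. dist (u c) (u d)) < \<epsilon>"
      by (rule \<delta>(2)[rule_format]) (use D in \<open>auto simp: nonoverlapping_def\<close>)
  qed (rule \<delta>(1))
qed

lemma abs_continuous_on_const: "abs_continuous_on I (\<lambda>_. c)"
  by (rule abs_continuous_onI) (auto simp: split_def intro: exI[of _ 1])

text \<open>A single comparison criterion serves sums, products, norms and Lipschitz functions: each
  of the three increments on the right is summed over the family and made smaller than a third of
  \<epsilon> divided by the constant.\<close>

lemma abs_continuous_on_dominated:
  fixes u :: "real \<Rightarrow> 'a::metric_space" and v :: "real \<Rightarrow> 'b::metric_space"
    and f :: "real \<Rightarrow> 'c::metric_space"
  assumes u: "abs_continuous_on I u" and v: "abs_continuous_on I v"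
    and f: "\<And>c d. c \<in> I \<Longrightarrow> d \<in> I \<Longrightarrow> c \<le> d \<Longrightarrow>
      dist (f c) (f d) \<le> M * (d - c + dist (u c) (u d) + dist (v c) (v d))"
  shows "abs_continuous_on I f"
proof (rule abs_continuous_onI)
  fix \<epsilon> :: real assume "\<epsilon> > 0"
  define K where "K = max M 1"
  define \<eta> where "\<eta> = \<epsilon> / (3 * K)"
  have K: "K > 0" "M \<le> K" by (auto simp: K_def)
  have "\<eta> > 0" using K \<open>\<epsilon> > 0\<close> by (simp add: \<eta>_def)
  obtain \<delta>1 where \<delta>1: "\<delta>1 > 0"
    "\<And>D. nonoverlapping D \<Longrightarrow> (\<And>c d. (c, d) \<in> D \<Longrightarrow> {c..d} \<subseteq> I) \<Longrightarrow> (\<Sum>(c, d)\<in>D. d - c) < \<delta>1 \<Longrightarrow>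
       (\<Sum>(c, d)\<in>D. dist (u c) (u d)) < \<eta>"
    using abs_continuous_onD[OF u \<open>\<eta> > 0\<close>] by blast
  obtain \<delta>2 where \<delta>2: "\<delta>2 > 0"
    "\<And>D. nonoverlapping D \<Longrightarrow> (\<And>c d. (c, d) \<in> D \<Longrightarrow> {c..d} \<subseteq> I) \<Longrightarrow> (\<Sum>(c, d)\<in>D. d - c) < \<delta>2 \<Longrightarrow>
       (\<Sum>(c, d)\<in>D. dist (v c) (v d)) < \<eta>"
    using abs_continuous_onD[OF v \<open>\<eta> > 0\<close>] by blast
  show "\<exists>\<delta>>0. \<forall>D. nonoverlapping D \<and> (\<forall>(c, d)\<in>D. {c..d} \<subseteq> I) \<and>
      (\<Sum>(c, d)\<in>D. d - c) < \<delta> \<longrightarrow> (\<Sum>(c, d)\<in>D. dist (f c) (f d)) < \<epsilon>"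
  proof (intro exI[of _ "min \<eta> (min \<delta>1 \<delta>2)"] conjI allI impI)
    fix D assume D: "nonoverlapping D \<and> (\<forall>(c, d)\<in>D. {c..d} \<subseteq> I) \<and>
      (\<Sum>(c, d)\<in>D. d - c) < min \<eta> (min \<delta>1 \<delta>2)"
    have *: "dist (f c) (f d) \<le> K * (d - c + dist (u c) (u d) + dist (v c) (v d))"
      if "(c, d) \<in> D" for c d
    proof -
      have cd: "c \<le> d" "c \<in> I" "d \<in> I"
        using D that by (fastforce simp: nonoverlapping_def)+
      have "dist (f c) (f d) \<le> M * (d - c + dist (u c) (u d) + dist (v c) (v d))"
        using f cd by blast
      also have "\<dots> \<le> K * (d - c + dist (u c) (u d) + dist (v c) (v d))"
        using cd K by (intro mult_right_mono) auto
      finally show ?thesis .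
    qed
    have "(\<Sum>(c, d)\<in>D. dist (f c) (f d))
      \<le> (\<Sum>(c, d)\<in>D. K * (d - c + dist (u c) (u d) + dist (v c) (v d)))"
      by (rule sum_mono) (use * in auto)
    also have "\<dots> = K * ((\<Sum>(c, d)\<in>D. d - c) + (\<Sum>(c, d)\<in>D. dist (u c) (u d))
        + (\<Sum>(c, d)\<in>D. dist (v c) (v d)))"
      by (simp add: split_def sum.distrib sum_distrib_left[symmetric])
    also have "\<dots> < K * (\<eta> + \<eta> + \<eta>)"
      using D K \<delta>1(2)[of D] \<delta>2(2)[of D] by (intro mult_strict_left_mono add_strict_mono) auto
    also have "\<dots> = \<epsilon>" using K by (simp add: \<eta>_def field_simps)
    finally show "(\<Sum>(c, d)\<in>D. dist (f c) (f d)) < \<epsilon>" .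
  qed (use \<open>\<eta> > 0\<close> \<delta>1(1) \<delta>2(1) in auto)
qed

lemma abs_continuous_on_shift:
  assumes "abs_continuous_on {a + h..b + h} u"
  shows "abs_continuous_on {a..b} (\<lambda>t. u (t + h))"
proof (rule abs_continuous_onI)
  fix \<epsilon> :: real assume "\<epsilon> > 0"
  obtain \<delta> where \<delta>: "\<delta> > 0"
    "\<And>D. nonoverlapping D \<Longrightarrow> (\<And>c d. (c, d) \<in> D \<Longrightarrow> {c..d} \<subseteq> {a + h..b + h}) \<Longrightarrow>
       (\<Sum>(c, d)\<in>D. d - c) < \<delta> \<Longrightarrow> (\<Sum>(c, d)\<in>D. dist (u c) (u d)) < \<epsilon>"
    using abs_continuous_onD[OF assms \<open>\<epsilon> > 0\<close>] by blast
  let ?s = "\<lambda>(c, d). (c + h, d + h)"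
  have inj: "inj_on ?s D" for D by (auto simp: inj_on_def)
  show "\<exists>\<delta>>0. \<forall>D. nonoverlapping D \<and> (\<forall>(c, d)\<in>D. {c..d} \<subseteq> {a..b}) \<and>
      (\<Sum>(c, d)\<in>D. d - c) < \<delta> \<longrightarrow> (\<Sum>(c, d)\<in>D. dist (u (c + h)) (u (d + h))) < \<epsilon>"
  proof (intro exI[of _ \<delta>] conjI allI impI)
    fix D assume D: "nonoverlapping D \<and> (\<forall>(c, d)\<in>D. {c..d} \<subseteq> {a..b}) \<and>
      (\<Sum>(c, d)\<in>D. d - c) < \<delta>"
    have shift: "{c + h<..<d + h} \<inter> {c' + h<..<d' + h} = {}"
      if "{c<..<d} \<inter> {c'<..<d'} = {}" for c d c' d'
    proof -
      have "x - h \<in> {c<..<d} \<inter> {c'<..<d'}" if "x \<in> {c + h<..<d + h} \<inter> {c' + h<..<d' + h}" for x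
        using that by (auto simp: algebra_simps)
      then show ?thesis using that by blast
    qed
    have "nonoverlapping (?s ` D)"
      using D unfolding nonoverlapping_def
      by (force simp: pairwise_def intro!: shift)
    moreover have "{c..d} \<subseteq> {a + h..b + h}" if "(c, d) \<in> ?s ` D" for c d
      using D that by (force simp: nonoverlapping_def)
    moreover have "(\<Sum>(c, d)\<in>?s ` D. d - c) < \<delta>"
      using D by (subst sum.reindex[OF inj]) (simp add: split_def)
    ultimately have "(\<Sum>(c, d)\<in>?s ` D. dist (u c) (u d)) < \<epsilon>"
      by (intro \<delta>(2))
    then show "(\<Sum>(c, d)\<in>D. dist (u (c + h)) (u (d + h))) < \<epsilon>"
      by (subst (asm) sum.reindex[OF inj]) (simp add: split_def)
  qed (rule \<delta>(1))
qed

lemma abs_continuous_on_imp_continuous_on: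
  assumes "abs_continuous_on {a..b} u"
  shows "continuous_on {a..b} u"
  unfolding continuous_on_iff
proof (intro ballI allI impI)
  fix x \<epsilon> :: real assume x: "x \<in> {a..b}" and "\<epsilon> > 0"
  obtain \<delta> where \<delta>: "\<delta> > 0"
    "\<And>D. nonoverlapping D \<Longrightarrow> (\<And>c d. (c, d) \<in> D \<Longrightarrow> {c..d} \<subseteq> {a..b}) \<Longrightarrow>
       (\<Sum>(c, d)\<in>D. d - c) < \<delta> \<Longrightarrow> (\<Sum>(c, d)\<in>D. dist (u c) (u d)) < \<epsilon>"
    using abs_continuous_onD[OF assms \<open>\<epsilon> > 0\<close>] by blast
  have "dist (u y) (u x) < \<epsilon>" if y: "y \<in> {a..b}" "dist y x < \<delta>" for y
    using \<delta>(2)[of "{(min x y, max x y)}"] x y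
    by (cases "x \<le> y") (auto simp: nonoverlapping_def dist_real_def dist_commute min_def max_def)
  then show "\<exists>d>0. \<forall>x'\<in>{a..b}. dist x' x < d \<longrightarrow> dist (u x') (u x) < \<epsilon>"
    using \<delta>(1) by blast
qed

lemma abs_continuous_on_add:
  fixes f g :: "real \<Rightarrow> 'a::real_normed_vector"
  assumes "abs_continuous_on I f" "abs_continuous_on I g"
  shows "abs_continuous_on I (\<lambda>t. f t + g t)"
  by (rule abs_continuous_on_dominated[OF assms, where M = 1])
    (use dist_triangle_add in \<open>fastforce intro: order_trans\<close>)

lemma abs_continuous_on_diff:
  fixes f g :: "real \<Rightarrow> 'a::real_normed_vector"
  assumes "abs_continuous_on I f" "abs_continuous_on I g"
  shows "abs_continuous_on I (\<lambda>t. f t - g t)"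
proof (rule abs_continuous_on_dominated[OF assms, where M = 1])
  fix c d :: real assume "c \<le> d"
  then show "dist (f c - g c) (f d - g d) \<le> 1 * (d - c + dist (f c) (f d) + dist (g c) (g d))"
    using norm_triangle_ineq4[of "f c - f d" "g c - g d"] by (simp add: dist_norm algebra_simps)
qed

lemma abs_continuous_on_norm:
  fixes f :: "real \<Rightarrow> 'a::real_normed_vector"
  assumes "abs_continuous_on I f"
  shows "abs_continuous_on I (\<lambda>t. norm (f t))"
proof (rule abs_continuous_on_dominated[OF assms abs_continuous_on_const[of _ "0::real"], where M = 1])
  fix c d :: real assume "c \<le> d"
  then show "dist (norm (f c)) (norm (f d)) \<le> 1 * (d - c + dist (f c) (f d) + dist (0::real) 0)"
    using norm_triangle_ineq3[of "f c" "f d"] by (simp add: dist_norm)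
qed

lemma abs_continuous_on_mult:
  fixes f g :: "real \<Rightarrow> real"
  assumes f: "abs_continuous_on {a..b} f" and g: "abs_continuous_on {a..b} g"
  shows "abs_continuous_on {a..b} (\<lambda>t. f t * g t)"
proof -
  have "bounded (f ` {a..b})" "bounded (g ` {a..b})"
    by (intro compact_imp_bounded compact_continuous_image compact_Icc
        abs_continuous_on_imp_continuous_on f g)+
  then obtain A B where AB: "\<And>t. t \<in> {a..b} \<Longrightarrow> \<bar>f t\<bar> \<le> A" "\<And>t. t \<in> {a..b} \<Longrightarrow> \<bar>g t\<bar> \<le> B"
    unfolding bounded_iff by fastforce
  show ?thesis
  proof (rule abs_continuous_on_dominated[OF f g, where M = "A + B"])
    fix c d assume cd: "c \<in> {a..b}" "d \<in> {a..b}" "c \<le> d"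
    have nonneg: "0 \<le> A" "0 \<le> B" using AB[OF cd(1)] by auto
    have "f c * g c - f d * g d = (f c - f d) * g c + f d * (g c - g d)" by (simp add: algebra_simps)
    then have "\<bar>f c * g c - f d * g d\<bar> \<le> \<bar>f c - f d\<bar> * \<bar>g c\<bar> + \<bar>f d\<bar> * \<bar>g c - g d\<bar>"
      by (metis abs_mult abs_triangle_ineq)
    also have "\<dots> \<le> \<bar>f c - f d\<bar> * B + A * \<bar>g c - g d\<bar>"
      using AB cd nonneg by (intro add_mono mult_mono) auto
    also have "\<dots> \<le> (A + B) * dist (f c) (f d) + (A + B) * dist (g c) (g d)"
      using nonneg by (simp add: dist_real_def algebra_simps)
    also have "\<dots> \<le> (A + B) * (d - c + dist (f c) (f d) + dist (g c) (g d))"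
      using nonneg cd by (simp add: distrib_left)
    finally show "dist (f c * g c) (f d * g d) \<le> (A + B) * (d - c + dist (f c) (f d) + dist (g c) (g d))"
      by (simp add: dist_real_def)
  qed
qed

lemma lipschitz_on_imp_abs_continuous_on:
  fixes f :: "real \<Rightarrow> 'a::metric_space"
  assumes "C-lipschitz_on I f"
  shows "abs_continuous_on I f"
  by (rule abs_continuous_on_dominated[OF abs_continuous_on_const[of _ "0::real"]
        abs_continuous_on_const[of _ "0::real"], where M = C])
    (use lipschitz_onD[OF assms] in \<open>fastforce simp: dist_real_def\<close>)

lemma C1_imp_abs_continuous_on:
  fixes f f' :: "real \<Rightarrow> real"
  assumes d: "\<And>t. (f has_real_derivative f' t) (at t)" and c: "continuous_on {a..b} f'"
  shows "abs_continuous_on {a..b} f"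
proof -
  have "bounded (f' ` {a..b})"
    by (intro compact_imp_bounded compact_continuous_image compact_Icc c)
  then obtain C where C: "\<And>t. t \<in> {a..b} \<Longrightarrow> \<bar>f' t\<bar> \<le> C"
    unfolding bounded_iff by fastforce
  have "(max C 0)-lipschitz_on {a..b} f"
  proof (rule lipschitz_onI)
    fix x y assume "x \<in> {a..b}" "y \<in> {a..b}"
    then show "dist (f x) (f y) \<le> max C 0 * dist x y"
      using field_differentiable_bound[of "{a..b}" f f' "max C 0" x y] C d
      by (fastforce simp: has_field_derivative_at_within dist_norm)
  qed simp
  then show ?thesis by (rule lipschitz_on_imp_abs_continuous_on)
qed

section \<open>Monotonicity from one-sided Dini estimates almost everywhere\<close>

text \<open>The open interiors are disjoint subsets of \<open>U\<close>, so their lengths add up to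
  at most the measure of \<open>U\<close>. This turns an open cover of small measure into the length
  bound required by absolute continuity.\<close>

lemma nonoverlapping_sum_less_measure:
  assumes "nonoverlapping D" "\<And>c d. (c, d) \<in> D \<Longrightarrow> {c..d} \<subseteq> U"
    and "U \<in> sets lborel" "emeasure lborel U < ennreal \<delta>"
  shows "(\<Sum>(c, d)\<in>D. d - c) < \<delta>"
proof -
  let ?A = "\<lambda>(c::real, d). {c<..<d}"
  have D: "finite D" "\<And>c d. (c, d) \<in> D \<Longrightarrow> c \<le> d"
    using assms(1) by (auto simp: nonoverlapping_def)
  have "disjoint_family_on ?A D"
    using assms(1) unfolding nonoverlapping_def disjoint_family_on_def pairwise_def by fastforce
  then have "(\<Sum>p\<in>D. emeasure lborel (?A p)) = emeasure lborel (\<Union>p\<in>D. ?A p)"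
    using D(1) by (intro sum_emeasure) (auto simp: split_def)
  also have "\<dots> \<le> emeasure lborel U"
    using assms(2,3) by (intro emeasure_mono) fastforce+
  also have "\<dots> < ennreal \<delta>" by fact
  also have "(\<Sum>p\<in>D. emeasure lborel (?A p)) = (\<Sum>p\<in>D. ennreal (case p of (c, d) \<Rightarrow> d - c))"
    by (intro sum.cong) (auto dest: D(2))
  also have "\<dots> = ennreal (\<Sum>(c, d)\<in>D. d - c)"
    by (intro sum_ennreal) (auto dest: D(2))
  finally show ?thesis
    using D(2) by (subst (asm) ennreal_less_iff) (auto intro!: sum_nonneg)
qed

text \<open>One moves leftwards from \<open>b\<close>. Outside \<open>N\<close> the Dini estimate
  permits a step at cost \<epsilon> per unit length. At a point of \<open>N\<close> one steps inside
  a small open cover \<open>U\<close>, where absolute continuity makes the total cost of all such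
  steps at most \<epsilon>.\<close>

lemma abs_continuous_on_Dini_le:
  fixes f :: "real \<Rightarrow> real"
  assumes ac: "abs_continuous_on {a..b} f" and "a \<le> b"
    and N: "N \<in> null_sets lborel"
    and dini: "\<And>t \<epsilon> \<eta>. a < t \<Longrightarrow> t \<le> b \<Longrightarrow> t \<notin> N \<Longrightarrow> \<epsilon> > 0 \<Longrightarrow> \<eta> > 0 \<Longrightarrow>
      \<exists>k. 0 < k \<and> k < \<eta> \<and> f t - f (t - k) \<le> \<epsilon> * k"
  shows "f b \<le> f a"
proof (rule field_le_epsilon)
  fix \<epsilon>' :: real assume "\<epsilon>' > 0"
  define \<epsilon> where "\<epsilon> = \<epsilon>' / (b - a + 1)"
  have "\<epsilon> > 0" using \<open>\<epsilon>' > 0\<close> \<open>a \<le> b\<close> by (simp add: \<epsilon>_def)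
  obtain \<delta> where \<delta>: "\<delta> > 0"
    "\<And>D. nonoverlapping D \<Longrightarrow> (\<And>c d. (c, d) \<in> D \<Longrightarrow> {c..d} \<subseteq> {a..b}) \<Longrightarrow>
       (\<Sum>(c, d)\<in>D. d - c) < \<delta> \<Longrightarrow> (\<Sum>(c, d)\<in>D. dist (f c) (f d)) < \<epsilon>"
    using abs_continuous_onD[OF ac \<open>\<epsilon> > 0\<close>] by blast
  obtain U where U: "open U" "N \<subseteq> U" "emeasure lborel (U - N) < ennreal \<delta>"
    using outer_regular_lborel[of N \<delta>] N \<delta>(1) by (auto simp: null_sets_def)
  have "emeasure lborel U = emeasure lborel (U - N)"
    using emeasure_Diff_null_set[OF N, of U] U(1) by simp
  with U have Um: "emeasure lborel U < ennreal \<delta>" by simp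
  \<comment> \<open>\<open>V s\<close> is the variation of \<open>f\<close> inside \<open>U\<close>
    to the right of \<open>s\<close>, the supremum of the increment sums \<open>W\<close> over the
    admissible families \<open>X s\<close>. It is the budget that pays for the steps taken at points
    of \<open>N\<close>.\<close>
  define X where "X s = {D. nonoverlapping D \<and> (\<forall>(c, d)\<in>D. {c..d} \<subseteq> U \<inter> {s..b})}" for s
  define W where "W D = (\<Sum>(c, d)\<in>D. dist (f c) (f d))" for D
  define V where "V s = Sup (W ` X s)" for s
  have W: "W D \<le> \<epsilon>" if "D \<in> X s" "a \<le> s" for D s
  proof -
    have "nonoverlapping D" "\<And>c d. (c, d) \<in> D \<Longrightarrow> {c..d} \<subseteq> U \<inter> {s..b}"
      using that by (auto simp: X_def)
    moreover from this have "(\<Sum>(c, d)\<in>D. d - c) < \<delta>"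
      using U(1) Um by (intro nonoverlapping_sum_less_measure[of D U]) auto
    ultimately show ?thesis
      using \<delta>(2)[of D] that(2) unfolding W_def by fastforce
  qed
  have bdd: "bdd_above (W ` X s)" if "a \<le> s" for s
    using W that by (intro bdd_aboveI[where M=\<epsilon>]) auto
  have empty: "{} \<in> X s" for s by (auto simp: X_def nonoverlapping_def)
  have V_le: "V s \<le> \<epsilon>" if "a \<le> s" for s
    unfolding V_def using W that empty by (intro cSUP_least) auto
  have V_mono: "V s' \<le> V s" if "a \<le> s" "s \<le> s'" for s s'
    unfolding V_def
  proof (rule cSUP_subset_mono)
    show "X s' \<subseteq> X s" using that by (fastforce simp: X_def)
  qed (use bdd that empty in auto)
  have V_step: "V s + dist (f r) (f s) \<le> V r"
    if rs: "a \<le> r" "r < s" "s \<le> b" "{r..s} \<subseteq> U" for r s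
  proof -
    have "V s \<le> V r - dist (f r) (f s)"
      unfolding V_def[of s]
    proof (rule cSUP_least)
      fix D assume D: "D \<in> X s"
      \<comment> \<open>The new interval must not already belong to the family, since otherwise
        inserting it would not add its increment to the sum.\<close>
      have "(r, s) \<notin> D" using D rs by (fastforce simp: X_def)
      have 1: "{r<..<s} \<inter> {c<..<d} = {} \<and> {c..d} \<subseteq> U \<inter> {r..b}" if "(c, d) \<in> D" for c d
      proof -
        have "{c..d} \<subseteq> U \<inter> {s..b}" "c \<le> d" using D that by (auto simp: X_def nonoverlapping_def)
        then have "s \<le> c" "{c..d} \<subseteq> U \<inter> {r..b}" using rs by fastforce+
        then show ?thesis by auto
      qed
      have 2: "finite D" "\<forall>(c, d)\<in>D. c \<le> d"
        "pairwise (\<lambda>(c, d) (c', d'). {c<..<d} \<inter> {c'<..<d'} = {}) D"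
        using D by (auto simp: X_def nonoverlapping_def)
      have "pairwise (\<lambda>(c, d) (c', d'). {c<..<d} \<inter> {c'<..<d'} = {}) (insert (r, s) D)"
        unfolding pairwise_insert using 1 2(3) by (auto simp: split_def min.commute max.commute)
      moreover have "\<forall>(c, d)\<in>insert (r, s) D. {c..d} \<subseteq> U \<inter> {r..b}"
        unfolding ball_simps using 1 rs by auto
      ultimately have "insert (r, s) D \<in> X r"
        using 2 rs(2) by (simp add: X_def nonoverlapping_def)
      then have "W (insert (r, s) D) \<le> V r"
        unfolding V_def using rs by (intro cSUP_upper bdd) auto
      moreover have "W (insert (r, s) D) = dist (f r) (f s) + W D"
        using D \<open>(r, s) \<notin> D\<close> by (simp add: W_def X_def nonoverlapping_def)
      ultimately show "W D \<le> V r - dist (f r) (f s)" by simp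
    qed (use empty in auto)
    then show ?thesis by simp
  qed
  define P where "P s \<longleftrightarrow> f b - f s \<le> \<epsilon> * (b - s) + V s" for s
  define A where "A = {s \<in> {a..b}. P s}"
  have "0 \<le> V b"
    unfolding V_def using empty bdd[OF \<open>a \<le> b\<close>] by (intro cSUP_upper2[of _ _ "{}"]) (auto simp: W_def)
  then have "b \<in> A" using \<open>a \<le> b\<close> by (simp add: A_def P_def)
  have bddA: "bdd_below A" by (rule bdd_belowI[of _ a]) (auto simp: A_def)
  define s where "s = Inf A"
  have "a \<le> s" "s \<le> b"
    using \<open>b \<in> A\<close> bddA by (auto simp: s_def A_def intro: cInf_lower cInf_greatest)
  \<comment> \<open>The infimum satisfies \<open>P\<close> itself: \<open>f\<close> is continuous,
    and both \<open>V\<close> and the linear term only grow when the argument moves left.\<close>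
  have "P s"
    unfolding P_def
  proof (rule field_le_epsilon)
    fix e :: real assume "e > 0"
    have "continuous_on {a..b} f" by (rule abs_continuous_on_imp_continuous_on[OF ac])
    then obtain d where d: "d > 0" "\<And>r. r \<in> {a..b} \<Longrightarrow> dist r s < d \<Longrightarrow> dist (f r) (f s) < e"
      using \<open>e > 0\<close> \<open>a \<le> s\<close> \<open>s \<le> b\<close> unfolding continuous_on_iff by (meson atLeastAtMost_iff)
    obtain r where r: "r \<in> A" "r < s + d"
      using cInf_lessD[of A "s + d"] \<open>b \<in> A\<close> d(1) by (auto simp: s_def)
    have "s \<le> r" unfolding s_def by (rule cInf_lower[OF r(1) bddA])
    have "dist (f r) (f s) < e"
      using r \<open>s \<le> r\<close> by (intro d(2)) (auto simp: A_def dist_real_def)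
    moreover have "V r \<le> V s" using \<open>a \<le> s\<close> \<open>s \<le> r\<close> by (rule V_mono)
    moreover have "\<epsilon> * (b - r) \<le> \<epsilon> * (b - s)"
      using \<open>\<epsilon> > 0\<close> \<open>s \<le> r\<close> by (intro mult_left_mono) auto
    moreover have "f b - f r \<le> \<epsilon> * (b - r) + V r" using r(1) by (simp add: A_def P_def)
    ultimately show "f b - f s \<le> \<epsilon> * (b - s) + V s + e" unfolding dist_real_def by linarith
  qed
  have "s = a"
  proof (rule ccontr)
    assume "s \<noteq> a"
    then have "a < s" using \<open>a \<le> s\<close> by simp
    \<comment> \<open>A point of \<open>A\<close> to the left of the infimum gives the
      contradiction; the two cases are the two kinds of step.\<close>
    have "\<exists>r. a \<le> r \<and> r < s \<and> P r"
    proof (cases "s \<in> N")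
      case False
      obtain k where k: "0 < k" "k < s - a" "f s - f (s - k) \<le> \<epsilon> * k"
        using dini[OF \<open>a < s\<close> \<open>s \<le> b\<close> False \<open>\<epsilon> > 0\<close>, of "s - a"] \<open>a < s\<close> by auto
      have "V s \<le> V (s - k)" using k by (intro V_mono) auto
      then have "P (s - k)"
        using \<open>P s\<close> k(3) by (simp add: P_def algebra_simps)
      then show ?thesis using k by (intro exI[of _ "s - k"]) auto
    next
      case True
      then have "s \<in> U" using U(2) by auto
      then obtain e where e: "e > 0" "cball s e \<subseteq> U"
        using U(1) open_contains_cball by blast
      define r where "r = max a (s - e)"
      have r: "a \<le> r" "r < s" using \<open>a < s\<close> e(1) by (auto simp: r_def)
      have "{r..s} \<subseteq> cball s e" by (auto simp: r_def dist_real_def)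
      then have "V s + dist (f r) (f s) \<le> V r"
        using r e(2) \<open>s \<le> b\<close> by (intro V_step) auto
      moreover have "\<epsilon> * (b - s) \<le> \<epsilon> * (b - r)"
        using \<open>\<epsilon> > 0\<close> r by (intro mult_left_mono) auto
      ultimately have "P r" using \<open>P s\<close> unfolding P_def dist_real_def by linarith
      then show ?thesis using r by blast
    qed
    then obtain r where "r \<in> A" "r < s" using \<open>s \<le> b\<close> by (force simp: A_def)
    then show False using cInf_lower[OF \<open>r \<in> A\<close> bddA] by (simp add: s_def)
  qed
  then have "f b - f a \<le> \<epsilon> * (b - a) + V a" using \<open>P s\<close> by (simp add: P_def)
  also have "\<dots> \<le> \<epsilon> * (b - a) + \<epsilon>" using V_le by simp
  also have "\<dots> = \<epsilon> * (b - a + 1)" by (simp add: algebra_simps)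
  also have "\<dots> = \<epsilon>'" using \<open>a \<le> b\<close> by (simp add: \<epsilon>_def)
  finally show "f b \<le> f a + \<epsilon>'" by simp
qed

lemma DERIV_nonpos_imp_Dini:
  fixes f :: "real \<Rightarrow> real"
  assumes "(f has_real_derivative D) (at t)" "D \<le> 0" "\<epsilon> > 0" "\<eta> > 0"
  shows "\<exists>k. 0 < k \<and> k < \<eta> \<and> f t - f (t - k) \<le> \<epsilon> * k"
proof -
  have "((\<lambda>s. (f s - f t) / (s - t)) \<longlongrightarrow> D) (at t)"
    using assms(1) by (simp add: has_field_derivative_iff)
  then have "\<forall>\<^sub>F s in at t. (f s - f t) / (s - t) < \<epsilon>"
    using assms(2,3) by (elim order_tendstoD) auto
  then obtain d where d: "d > 0" "\<And>s. s \<noteq> t \<Longrightarrow> dist s t < d \<Longrightarrow> (f s - f t) / (s - t) < \<epsilon>"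
    unfolding eventually_at by blast
  define k where "k = min d \<eta> / 2"
  have k: "0 < k" "k < \<eta>" "k < d" using d assms by (auto simp: k_def)
  then have "(f (t - k) - f t) / (- k) < \<epsilon>"
    using d(2)[of "t - k"] by (simp add: dist_real_def)
  then show ?thesis using k by (intro exI[of _ k]) (simp add: field_simps)
qed

section \<open>Weakly convergent difference quotients\<close>

text \<open>If \<open>w\<close> represents \<open>L\<close>, the bound is the squared norm of
  \<open>L\<close> minus \<epsilon>; an arbitrary \<open>w\<close> is allowed, so no representing
  vector has to be found. If the bound failed eventually, then \<open>L\<close> would be at most
  \<open>c\<close> on the convex hull of the late \<open>e k\<close>. A nearly shortest
  \<open>x\<close> in that hull satisfies \<open>e k \<bullet> x \<ge> (norm x)\<^sup>2\<close> up
  to a small error, and in the limit \<open>L x\<close> is too large.\<close>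

lemma frequently_weak_limit_ge:
  fixes e :: "'b \<Rightarrow> 'a::real_inner" and L :: "'a \<Rightarrow> real"
  assumes "F \<noteq> bot"
    and lim: "\<And>v. ((\<lambda>k. e k \<bullet> v) \<longlongrightarrow> L v) F"
    and bd: "eventually (\<lambda>k. norm (e k) \<le> C) F"
    and "linear L" and "\<epsilon> > 0"
  shows "\<exists>\<^sub>F k in F. L (e k) \<ge> 2 * L w - (norm w)\<^sup>2 - \<epsilon>"
proof (rule ccontr)
  define c where "c = 2 * L w - (norm w)\<^sup>2 - \<epsilon>"
  define A where "A = {k. L (e k) < c \<and> norm (e k) \<le> C \<and> \<bar>e k \<bullet> w - L w\<bar> < \<epsilon> / 8}"
  define S where "S = convex hull (e ` A)"
  interpret L: linear L by fact
  assume "\<not> ?thesis"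
  then have "eventually (\<lambda>k. L (e k) < c) F"
    by (simp add: frequently_def c_def not_le)
  moreover have "eventually (\<lambda>k. \<bar>e k \<bullet> w - L w\<bar> < \<epsilon> / 8) F"
    using tendstoD[OF lim[of w], of "\<epsilon> / 8"] \<open>\<epsilon> > 0\<close> by (simp add: dist_real_def)
  ultimately have evA: "eventually (\<lambda>k. k \<in> A) F"
    using bd unfolding A_def by eventually_elim simp
  then have "A \<noteq> {}"
    using eventually_happens'[OF \<open>F \<noteq> bot\<close>] by fast
  then have "S \<noteq> {}" by (simp add: S_def)
  have S_ind: "x \<in> X" if "x \<in> S" "convex X" "\<And>k. k \<in> A \<Longrightarrow> e k \<in> X" for x X
    using hull_minimal[of "e ` A" X convex] that by (auto simp: S_def)
  have "convex {x. L x \<le> c}"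
    unfolding convex_def by (auto simp: L.add L.scale intro: convex_bound_le)
  then have SL: "L x \<le> c" if "x \<in> S" for x
    using S_ind[OF that, of "{x. L x \<le> c}"] by (auto simp: A_def)
  have *: "convex {x. L w - \<epsilon> / 8 \<le> x \<bullet> w}"
    using convex_halfspace_ge[of "L w - \<epsilon> / 8" w] by (simp add: inner_commute)
  have Sw: "L w - \<epsilon> / 8 \<le> x \<bullet> w" if "x \<in> S" for x
  proof -
    have "e k \<in> {x. L w - \<epsilon> / 8 \<le> x \<bullet> w}" if "k \<in> A" for k
      using that unfolding A_def mem_Collect_eq by linarith
    then show ?thesis
      using S_ind[OF that, of "{x. L w - \<epsilon> / 8 \<le> x \<bullet> w}"] * by blast
  qed
  have SC: "norm x \<le> C" if "x \<in> S" for x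
    using S_ind[OF that, of "cball 0 C"] by (auto simp: A_def)
  \<comment> \<open>\<open>K\<close> bounds \<open>1 + (norm (e k - x))\<^sup>2\<close> for points
    of the hull, and \<open>s\<close> is the step length from \<open>x\<close> towards
    \<open>e k\<close>.\<close>
  define K where "K = 1 + 4 * C\<^sup>2"
  have "K > 0" by (simp add: K_def add_pos_nonneg)
  define s where "s = min 1 (\<epsilon> / (4 * K))"
  have s: "0 < s" "s \<le> 1" "s * K \<le> \<epsilon> / 4"
    using \<open>\<epsilon> > 0\<close> \<open>K > 0\<close> by (auto simp: s_def min_def field_simps)
  define I where "I = (INF x\<in>S. (norm x)\<^sup>2)"
  have bdd: "bdd_below ((\<lambda>x. (norm x)\<^sup>2) ` S)"
    by (rule bdd_belowI[where m=0]) auto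
  \<comment> \<open>Near-minimality up to \<open>s\<^sup>2\<close> is the right precision: after
    division by the step length \<open>s\<close> only an error of order \<open>s\<close> is
    left.\<close>
  have "\<exists>x\<in>S. (norm x)\<^sup>2 < I + s\<^sup>2"
    using cINF_less_iff[OF \<open>S \<noteq> {}\<close> bdd, of "I + s\<^sup>2"] s by (simp add: I_def)
  then obtain x where x: "x \<in> S" "(norm x)\<^sup>2 < I + s\<^sup>2" by blast
  have "e k \<bullet> x \<ge> (norm x)\<^sup>2 - s * K" if "k \<in> A" for k
  proof -
    have kS: "e k \<in> S" unfolding S_def using that by (simp add: hull_inc)
    have "(1 - s) *\<^sub>R x + s *\<^sub>R e k \<in> S"
      using s x(1) kS by (intro convexD_alt) (auto simp: S_def)
    then have "I \<le> (norm ((1 - s) *\<^sub>R x + s *\<^sub>R e k))\<^sup>2"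
      unfolding I_def by (intro cINF_lower[OF bdd])
    also have "(1 - s) *\<^sub>R x + s *\<^sub>R e k = x + s *\<^sub>R (e k - x)"
      by (simp add: algebra_simps)
    also have "(norm (x + s *\<^sub>R (e k - x)))\<^sup>2
        = (norm x)\<^sup>2 + s * (2 * (e k \<bullet> x) - 2 * (norm x)\<^sup>2) + s * (s * (norm (e k - x))\<^sup>2)"
      by (simp add: power2_norm_eq_inner inner_simps inner_commute algebra_simps)
    finally have "0 \<le> s * (s + (2 * (e k \<bullet> x) - 2 * (norm x)\<^sup>2) + s * (norm (e k - x))\<^sup>2)"
      using x(2) by (simp add: algebra_simps power2_eq_square)
    then have 1: "0 \<le> s + (2 * (e k \<bullet> x) - 2 * (norm x)\<^sup>2) + s * (norm (e k - x))\<^sup>2"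
      using s by (simp add: zero_le_mult_iff)
    have "norm (e k - x) \<le> 2 * C"
      using SC[OF kS] SC[OF x(1)] norm_triangle_ineq4[of "e k" x] by linarith
    then have "(norm (e k - x))\<^sup>2 \<le> (2 * C)\<^sup>2" by (intro power_mono) auto
    then have "s * (norm (e k - x))\<^sup>2 \<le> s * (4 * C\<^sup>2)"
      using s by (intro mult_left_mono) (auto simp: power_mult_distrib)
    then have "0 \<le> s * K + 2 * (e k \<bullet> x) - 2 * (norm x)\<^sup>2"
      using 1 by (simp add: K_def algebra_simps)
    moreover have "0 \<le> s * K" using s \<open>K > 0\<close> by simp
    ultimately show ?thesis by linarith
  qed
  then have "eventually (\<lambda>k. (norm x)\<^sup>2 - s * K \<le> e k \<bullet> x) F"
    using evA by (auto elim: eventually_mono)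
  then have "(norm x)\<^sup>2 - s * K \<le> L x"
    using tendsto_lowerbound[OF lim] \<open>F \<noteq> bot\<close> by blast
  moreover have "0 \<le> (norm (x - w))\<^sup>2" by simp
  then have "2 * (x \<bullet> w) - (norm w)\<^sup>2 \<le> (norm x)\<^sup>2"
    by (simp add: power2_norm_eq_inner inner_simps inner_commute)
  ultimately show False
    using SL[OF x(1)] Sw[OF x(1)] s \<open>\<epsilon> > 0\<close> unfolding c_def by linarith
qed

section \<open>The time change kappa\<close>

lemma kappa_0 [simp]: "kappa 0 s = 0"
  by (simp add: kappa_def)

lemma exp_eq_kappa: "exp (2 * s * t) = 1 + 2 * s * kappa t s"
  by (simp add: kappa_def)

lemma has_derivative_kappa: "((\<lambda>t. kappa t s) has_real_derivative exp (2 * s * t)) (at t)"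
  by (cases "s = 0") (auto simp: kappa_def intro!: derivative_eq_intros)

lemma kappa_pos:
  assumes "0 < t"
  shows "0 < kappa t s"
  using DERIV_pos_imp_increasing[OF assms, of "\<lambda>t. kappa t s"] has_derivative_kappa[of s] by force

section \<open>Flows satisfying the evolution variational inequality\<close>

text \<open>The weak derivative is kept as a functional, because \<open>u\<close> need not have a
  derivative in the norm. The value of \<open>deriv\<close> carries information only where the
  scalar function is differentiable, which is shown at good times.\<close>

definition velocity :: "(real \<Rightarrow> 'a::real_inner) \<Rightarrow> real \<Rightarrow> 'a \<Rightarrow> real" where
  "velocity u t v = deriv (\<lambda>s. u s \<bullet> v) t"

text \<open>The exceptional null set is fixed as \<open>N\<close>, so that a good time is a positive
  \<open>t\<close> outside \<open>N\<close>, where the inequality holds against every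
  \<open>v\<close> and the energy is finite.\<close>

locale evi_flow =
  fixes l :: real and \<Phi> :: "'a::real_inner \<Rightarrow> ereal" and u :: "real \<Rightarrow> 'a" and N :: "real set"
  assumes lac: "locally_abs_continuous u"
    and null: "N \<in> null_sets lborel"
    and finite: "\<And>t. t > 0 \<Longrightarrow> t \<notin> N \<Longrightarrow> \<bar>\<Phi> (u t)\<bar> \<noteq> \<infinity>"
    and evi: "\<And>t v. t > 0 \<Longrightarrow> t \<notin> N \<Longrightarrow>
      \<exists>D. ((\<lambda>s. (norm (u s - v))\<^sup>2) has_real_derivative D) (at t) \<and>
        ereal (1/2 * D + 1/2 * l * (norm (u t - v))\<^sup>2) + \<Phi> (u t) \<le> \<Phi> v"
begin

text \<open>The conversion returns 0 at infinite values, so this is the energy along the curve only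
  at times where that energy is finite, in particular at good times.\<close>

definition \<phi> :: "real \<Rightarrow> real" where
  "\<phi> t = real_of_ereal (\<Phi> (u t))"

lemma ereal_\<phi>: "t > 0 \<Longrightarrow> t \<notin> N \<Longrightarrow> ereal (\<phi> t) = \<Phi> (u t)"
  using finite by (simp add: \<phi>_def ereal_real')

text \<open>Polarization: the inner product is a combination of the squared distances to 0 and to
  \<open>v\<close>, both differentiable by the variational inequality.\<close>

lemma has_derivative_inner:
  assumes "t > 0" "t \<notin> N"
  shows "((\<lambda>s. u s \<bullet> v) has_real_derivative velocity u t v) (at t)"
proof -
  obtain D0 where D0: "((\<lambda>s. (norm (u s - 0))\<^sup>2) has_real_derivative D0) (at t)"
    using evi[OF assms] by blast
  obtain D where D: "((\<lambda>s. (norm (u s - v))\<^sup>2) has_real_derivative D) (at t)"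
    using evi[OF assms] by blast
  have "(\<lambda>s. u s \<bullet> v) = (\<lambda>s. ((norm (u s - 0))\<^sup>2 - (norm (u s - v))\<^sup>2 + (norm v)\<^sup>2) / 2)"
    by (simp add: power2_norm_eq_inner inner_simps inner_commute)
  moreover have "((\<lambda>s. ((norm (u s - 0))\<^sup>2 - (norm (u s - v))\<^sup>2 + (norm v)\<^sup>2) / 2)
      has_real_derivative (D0 - D + 0) / 2) (at t)"
    by (intro DERIV_cdivide DERIV_add DERIV_diff D0 D DERIV_const)
  ultimately show ?thesis
    unfolding velocity_def by (metis DERIV_deriv_iff_has_field_derivative)
qed

lemma linear_velocity:
  assumes "t > 0" "t \<notin> N"
  shows "linear (velocity u t)"
proof
  fix x y :: 'a and r :: real
  note d = has_derivative_inner[OF assms]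
  have "((\<lambda>s. u s \<bullet> (x + y)) has_real_derivative velocity u t x + velocity u t y) (at t)"
    unfolding inner_add_right by (intro DERIV_add d)
  then show "velocity u t (x + y) = velocity u t x + velocity u t y"
    using d DERIV_unique by blast
  have "((\<lambda>s. u s \<bullet> (r *\<^sub>R x)) has_real_derivative r * velocity u t x) (at t)"
    unfolding inner_scaleR_right by (intro DERIV_cmult d)
  then show "velocity u t (r *\<^sub>R x) = r *\<^sub>R velocity u t x"
    using d DERIV_unique by (metis real_scaleR_def)
qed

text \<open>
  At \<open>v = u t\<close> the function \<open>s \<mapsto> \<parallel>u s - v\<parallel>\<^sup>2\<close> has a minimum, so its derivative vanishes;
  this identifies the derivative of \<open>\<parallel>u s\<parallel>\<^sup>2\<close> although \<open>u\<close> is only weakly differentiable.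
\<close>

lemma has_derivative_norm_diff_sq:
  assumes "t > 0" "t \<notin> N"
  shows "((\<lambda>s. (norm (u s - v))\<^sup>2) has_real_derivative 2 * velocity u t (u t - v)) (at t)"
proof -
  interpret L: linear "velocity u t" by (rule linear_velocity[OF assms])
  obtain D where D: "((\<lambda>s. (norm (u s - u t))\<^sup>2) has_real_derivative D) (at t)"
    using evi[OF assms] by blast
  have "D = 0" by (rule DERIV_local_min[OF D, of 1]) auto
  have "(\<lambda>s. (norm (u s - v))\<^sup>2)
      = (\<lambda>s. (norm (u s - u t))\<^sup>2 + 2 * (u s \<bullet> (u t - v)) + ((norm v)\<^sup>2 - (norm (u t))\<^sup>2))"
    by (auto simp: power2_norm_eq_inner inner_simps inner_commute)
  moreover have "((\<lambda>s. (norm (u s - u t))\<^sup>2 + 2 * (u s \<bullet> (u t - v)) + ((norm v)\<^sup>2 - (norm (u t))\<^sup>2))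
      has_real_derivative D + 2 * velocity u t (u t - v) + 0) (at t)"
    by (intro DERIV_add DERIV_cmult D has_derivative_inner[OF assms] DERIV_const)
  ultimately show ?thesis using \<open>D = 0\<close> by simp
qed

lemma evi_velocity:
  assumes "t > 0" "t \<notin> N" "\<Phi> v = ereal r"
  shows "velocity u t (u t - v) + l / 2 * (norm (u t - v))\<^sup>2 + \<phi> t \<le> r"
proof -
  obtain D where D: "((\<lambda>s. (norm (u s - v))\<^sup>2) has_real_derivative D) (at t)"
    "ereal (1/2 * D + 1/2 * l * (norm (u t - v))\<^sup>2) + \<Phi> (u t) \<le> \<Phi> v"
    using evi[OF assms(1,2)] by blast
  have "D = 2 * velocity u t (u t - v)"
    using D(1) has_derivative_norm_diff_sq[OF assms(1,2)] DERIV_unique by blast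
  then show ?thesis
    using D(2) assms(3) ereal_\<phi>[OF assms(1,2), symmetric] by simp
qed

lemma evi_velocity_flow:
  assumes "t > 0" "t \<notin> N" "s > 0" "s \<notin> N"
  shows "velocity u t (u t - u s) + l / 2 * (norm (u t - u s))\<^sup>2 + \<phi> t \<le> \<phi> s"
  using assms ereal_\<phi>[of s] by (intro evi_velocity) auto

section \<open>Contraction and Lipschitz regularity\<close>

text \<open>Both times move at once. Expanding around the two base points leaves the mixed term
  \<open>R\<close>, which is dominated by the sum \<open>Q\<close> of squared displacements. Each
  square in \<open>Q\<close> is minimal at \<open>t\<close>, so \<open>Q\<close>, and with it
  \<open>R\<close>, has derivative 0 there.\<close>

lemma has_derivative_norm_increment_sq:
  assumes t: "t > 0" "t \<notin> N" and th: "t + h > 0" "t + h \<notin> N"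
  shows "((\<lambda>s. (norm (u (s + h) - u s))\<^sup>2) has_real_derivative
      2 * velocity u (t + h) (u (t + h) - u t) + 2 * velocity u t (u t - u (t + h))) (at t)"
proof -
  define R where "R s = (u (s + h) - u (t + h)) \<bullet> (u s - u t)" for s
  define Q where "Q s = (norm (u (s + h) - u (t + h)))\<^sup>2 + (norm (u s - u t))\<^sup>2" for s
  interpret L: linear "velocity u t" by (rule linear_velocity[OF t])
  interpret L': linear "velocity u (t + h)" by (rule linear_velocity[OF th])
  have shift: "((\<lambda>s. (norm (u (s + h) - v))\<^sup>2) has_real_derivative
      2 * velocity u (t + h) (u (t + h) - v)) (at t)" for v
    using has_derivative_norm_diff_sq[OF th, of v] by (simp add: DERIV_shift)
  have "(Q has_real_derivative 2 * velocity u (t + h) (u (t + h) - u (t + h))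
      + 2 * velocity u t (u t - u t)) (at t)"
    unfolding Q_def by (intro DERIV_add shift has_derivative_norm_diff_sq t)
  then have Q: "(Q has_real_derivative 0) (at t)" by (simp add: L.zero L'.zero)
  have RQ: "\<bar>R s\<bar> \<le> Q s" for s
  proof -
    have "\<bar>R s\<bar> \<le> norm (u (s + h) - u (t + h)) * norm (u s - u t)"
      unfolding R_def by (rule Cauchy_Schwarz_ineq2)
    also have "\<dots> \<le> Q s"
      using sum_squares_bound[of "norm (u (s + h) - u (t + h))" "norm (u s - u t)"]
        mult_nonneg_nonneg[OF norm_ge_zero norm_ge_zero, of "u (s + h) - u (t + h)" "u s - u t"]
      unfolding Q_def by linarith
    finally show ?thesis .
  qed
  have R: "(R has_real_derivative 0) (at t)"
    unfolding has_field_derivative_iff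
  proof (rule Lim_null_comparison)
    have "((\<lambda>s. (Q s - Q t) / (s - t)) \<longlongrightarrow> 0) (at t)"
      using Q by (simp add: has_field_derivative_iff)
    then show "((\<lambda>s. \<bar>(Q s - Q t) / (s - t)\<bar>) \<longlongrightarrow> 0) (at t)"
      by (rule tendsto_rabs_zero)
    have "norm ((R s - R t) / (s - t)) \<le> \<bar>(Q s - Q t) / (s - t)\<bar>" for s
      using RQ[of s] by (simp add: R_def Q_def abs_divide divide_right_mono)
    then show "\<forall>\<^sub>F s in at t. norm ((R s - R t) / (s - t)) \<le> \<bar>(Q s - Q t) / (s - t)\<bar>"
      by simp
  qed
  have "(\<lambda>s. (norm (u (s + h) - u s))\<^sup>2)
      = (\<lambda>s. (norm (u (s + h) - u t))\<^sup>2 + (norm (u s - u (t + h)))\<^sup>2 - 2 * R s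
          - (norm (u (t + h) - u t))\<^sup>2)"
    by (auto simp: R_def power2_norm_eq_inner inner_simps inner_commute)
  moreover have "((\<lambda>s. (norm (u (s + h) - u t))\<^sup>2 + (norm (u s - u (t + h)))\<^sup>2 - 2 * R s
          - (norm (u (t + h) - u t))\<^sup>2) has_real_derivative
      2 * velocity u (t + h) (u (t + h) - u t) + 2 * velocity u t (u t - u (t + h)) - 2 * 0 - 0) (at t)"
    by (intro DERIV_add DERIV_diff DERIV_cmult DERIV_const shift has_derivative_norm_diff_sq t R)
  ultimately show ?thesis by simp
qed

lemma continuous_on_flow: "0 < a \<Longrightarrow> continuous_on {a..b} u"
  using lac abs_continuous_on_imp_continuous_on[of a b u]
  by (cases "a \<le> b") (auto simp: locally_abs_continuous_def)

text \<open>Adding the inequality at \<open>t\<close> tested with \<open>u (t + h)\<close> to the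
  one at \<open>t + h\<close> tested with \<open>u t\<close> cancels the energies. What remains says
  that \<open>exp (2 * l * t)\<close> times the squared increment has nonpositive derivative at
  almost every time.\<close>

lemma contraction:
  assumes "0 < a" "a \<le> b" "0 \<le> h"
  shows "exp (l * b) * norm (u (b + h) - u b) \<le> exp (l * a) * norm (u (a + h) - u a)"
proof -
  define w where "w s = u (s + h) - u s" for s
  define f where "f s = (exp (l * s))\<^sup>2 * (norm (w s))\<^sup>2" for s
  \<comment> \<open>Both \<open>t\<close> and \<open>t + h\<close> have to be good times.\<close>
  define N' where "N' = N \<union> {s. s - (- h) \<in> N}"
  have N': "N' \<in> null_sets lborel"
    unfolding N'_def by (intro null_sets.Un null null_sets_translation)
  have ac1: "abs_continuous_on {a..b} u"
    using lac assms by (simp add: locally_abs_continuous_def)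
  have ac2: "abs_continuous_on {a..b} (\<lambda>s. u (s + h))"
    using lac assms by (intro abs_continuous_on_shift) (simp add: locally_abs_continuous_def)
  define g where "g s = (exp (l * s))\<^sup>2" for s
  have dg: "(g has_real_derivative 2 * l * g s) (at s)" for s
    unfolding g_def by (auto intro!: derivative_eq_intros simp: power2_eq_square)
  have "abs_continuous_on {a..b} g"
    by (rule C1_imp_abs_continuous_on[OF dg]) (auto simp: g_def intro!: continuous_intros)
  then have "abs_continuous_on {a..b} f"
    unfolding f_def g_def[symmetric] w_def power2_eq_square[of "norm _"]
    by (intro abs_continuous_on_mult abs_continuous_on_norm abs_continuous_on_diff ac1 ac2)
  then have "f b \<le> f a"
  proof (rule abs_continuous_on_Dini_le[OF _ \<open>a \<le> b\<close> N'])
    fix t \<epsilon> \<eta> :: real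
    assume t: "a < t" "t \<le> b" "t \<notin> N'" and "\<epsilon> > 0" "\<eta> > 0"
    then have good: "t > 0" "t \<notin> N" "t + h > 0" "t + h \<notin> N"
      using assms by (auto simp: N'_def)
    define D where "D = 2 * velocity u (t + h) (u (t + h) - u t) + 2 * velocity u t (u t - u (t + h))"
    have "(f has_real_derivative 2 * l * g t * (norm (w t))\<^sup>2 + D * g t) (at t)"
      unfolding f_def w_def g_def[symmetric] D_def
      by (intro DERIV_mult dg has_derivative_norm_increment_sq good)
    moreover have "D \<le> - 2 * l * (norm (w t))\<^sup>2"
      using evi_velocity_flow[OF good(1,2,3,4)] evi_velocity_flow[OF good(3,4,1,2)]
      by (simp add: D_def w_def norm_minus_commute)
    then have "D * g t \<le> - 2 * l * (norm (w t))\<^sup>2 * g t"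
      by (rule mult_right_mono) (simp add: g_def)
    then have "2 * l * g t * (norm (w t))\<^sup>2 + D * g t \<le> 0" by (simp add: algebra_simps)
    ultimately show "\<exists>k. 0 < k \<and> k < \<eta> \<and> f t - f (t - k) \<le> \<epsilon> * k"
      using \<open>\<epsilon> > 0\<close> \<open>\<eta> > 0\<close> by (rule DERIV_nonpos_imp_Dini)
  qed
  then have "(exp (l * b) * norm (w b))\<^sup>2 \<le> (exp (l * a) * norm (w a))\<^sup>2"
    by (simp only: f_def power_mult_distrib)
  then show ?thesis
    unfolding w_def by (rule power2_le_imp_le) simp
qed

text \<open>
  The increments over the equal pieces of a short interval ending at \<open>a\<close> sum up to less than
  \<open>1\<close>, and by the contraction each of them bounds every later increment.
\<close>

lemma lipschitz_flow:
  assumes "0 < a"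
  obtains C where "C-lipschitz_on {a..b} u"
proof -
  have "abs_continuous_on {a / 2..a} u"
    using lac assms by (simp add: locally_abs_continuous_def)
  then obtain \<delta> where \<delta>: "\<delta> > 0"
    "\<And>D. nonoverlapping D \<Longrightarrow> (\<And>c d. (c, d) \<in> D \<Longrightarrow> {c..d} \<subseteq> {a / 2..a}) \<Longrightarrow>
       (\<Sum>(c, d)\<in>D. d - c) < \<delta> \<Longrightarrow> (\<Sum>(c, d)\<in>D. dist (u c) (u d)) < 1"
    using abs_continuous_onD[of "{a / 2..a}" u 1] by (metis zero_less_one)
  define m where "m = min (a / 2) (\<delta> / 2)"
  have m: "0 < m" "m \<le> a / 2" "m < \<delta>" using \<delta>(1) assms by (auto simp: m_def)
  \<comment> \<open>\<open>M\<close> bounds the exponential factor that the contraction produces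
    between a sample point \<open>x i\<close> and a later time up to \<open>b\<close>.\<close>
  define M where "M = exp (\<bar>l\<bar> * b)"
  have incr: "dist (u (t + h)) (u t) \<le> 2 * M / m * h" if t: "a \<le> t" "t \<le> b" and h: "0 < h" "h \<le> m" for t h
  proof -
    define n where "n = nat \<lfloor>m / h\<rfloor>"
    have "1 \<le> m / h" using h by simp
    then have n: "real n \<le> m / h" "m / h < real n + 1" "1 \<le> real n"
      unfolding n_def by (auto simp: le_nat_iff)
    define x where "x i = a - m + real i * h" for i
    let ?p = "\<lambda>i. (x i, x (Suc i))"
    define D where "D = ?p ` {..<n}"
    have x_mono: "x i \<le> x j" if "i \<le> j" for i j
      using that h by (simp add: x_def)
    have x_bounds: "a / 2 \<le> x i" "x i \<le> a" if "i \<le> n" for i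
    proof -
      have "real i * h \<le> m / h * h" using that n(1) h by (intro mult_right_mono) auto
      moreover have "0 \<le> real i * h" using h by simp
      moreover have "m / h * h = m" using h by simp
      ultimately show "a / 2 \<le> x i" "x i \<le> a" using m(2) unfolding x_def by linarith+
    qed
    have inj: "inj_on ?p {..<n}" using h by (auto simp: inj_on_def x_def)
    have "nonoverlapping D"
      unfolding nonoverlapping_def
    proof (intro conjI)
      show "\<forall>(c, d)\<in>D. c \<le> d"
        using h(1) by (auto simp: D_def x_def)
      show "pairwise (\<lambda>(c, d) (c', d'). {c<..<d} \<inter> {c'<..<d'} = {}) D"
      proof (rule pairwiseI)
        fix p q assume "p \<in> D" "q \<in> D" "p \<noteq> q"
        then obtain i j where ij: "p = ?p i" "q = ?p j" "i \<noteq> j" by (auto simp: D_def)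
        then have "x (Suc i) \<le> x j \<or> x (Suc j) \<le> x i"
          using x_mono[of "Suc i" j] x_mono[of "Suc j" i] by linarith
        then show "(\<lambda>(c, d) (c', d'). {c<..<d} \<inter> {c'<..<d'} = {}) p q"
          unfolding ij by auto
      qed
    qed (simp add: D_def)
    moreover have "{c..d} \<subseteq> {a / 2..a}" if cd: "(c, d) \<in> D" for c d
    proof -
      obtain i where "i < n" "c = x i" "d = x (Suc i)" using cd by (auto simp: D_def)
      then show ?thesis using x_bounds(1)[of i] x_bounds(2)[of "Suc i"] by auto
    qed
    moreover have "(\<Sum>(c, d)\<in>D. d - c) = real n * h"
      unfolding D_def by (subst sum.reindex[OF inj]) (simp add: x_def algebra_simps)
    moreover have "real n * h \<le> m" using n(1) h by (simp add: pos_le_divide_eq)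
    ultimately have "(\<Sum>(c, d)\<in>D. dist (u c) (u d)) < 1"
      using m(3) by (intro \<delta>(2)) auto
    then have sum: "(\<Sum>i<n. dist (u (x i)) (u (x (Suc i)))) < 1"
      unfolding D_def by (subst (asm) sum.reindex[OF inj]) simp
    have "dist (u (t + h)) (u t) / M \<le> dist (u (x i)) (u (x (Suc i)))" if "i < n" for i
    proof -
      have xi: "0 < x i" "x i \<le> t" "x (Suc i) = x i + h"
        using x_bounds[of i] that t assms by (auto simp: x_def algebra_simps)
      have "l * (x i - t) \<le> \<bar>l\<bar> * b"
      proof -
        have "l * (x i - t) \<le> \<bar>l\<bar> * \<bar>x i - t\<bar>" by (metis abs_ge_self abs_mult)
        also have "\<dots> \<le> \<bar>l\<bar> * b" using xi t by (intro mult_left_mono) auto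
        finally show ?thesis .
      qed
      then have M: "exp (l * x i) \<le> M * exp (l * t)"
        unfolding M_def by (simp add: exp_add[symmetric] algebra_simps)
      have "exp (l * t) * dist (u (t + h)) (u t) \<le> exp (l * x i) * dist (u (x i)) (u (x i + h))"
        using contraction[OF xi(1,2), of h] h by (simp add: dist_norm norm_minus_commute)
      also have "\<dots> \<le> (M * exp (l * t)) * dist (u (x i)) (u (x i + h))"
        using M by (intro mult_right_mono) auto
      finally have "dist (u (t + h)) (u t) \<le> M * dist (u (x i)) (u (x i + h))" by simp
      then show ?thesis unfolding xi(3) by (simp add: M_def field_simps)
    qed
    then have "(\<Sum>i<n. dist (u (t + h)) (u t) / M) \<le> (\<Sum>i<n. dist (u (x i)) (u (x (Suc i))))"
      by (intro sum_mono) auto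
    then have 1: "real n * (dist (u (t + h)) (u t) / M) \<le> 1" using sum by simp
    \<comment> \<open>Rounding \<open>m / h\<close> down to \<open>n\<close> loses at most a factor
      2, as \<open>n\<close> is at least 1; this is the 2 in the Lipschitz constant.\<close>
    have "m / h \<le> 2 * real n" using n by linarith
    then have "m / h * (dist (u (t + h)) (u t) / M) \<le> 2 * real n * (dist (u (t + h)) (u t) / M)"
      by (intro mult_right_mono) (auto simp: M_def)
    then have "m / h * (dist (u (t + h)) (u t) / M) \<le> 2" using 1 by simp
    then show ?thesis using h m(1) by (simp add: M_def field_simps)
  qed
  \<comment> \<open>The increment bound covers only steps of length at most \<open>m\<close>;
    continuity lets these local estimates be chained.\<close>
  have "(2 * M / m)-lipschitz_on {a..b} u"
  proof (rule locally_lipschitz_imp_lipschitz)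
    fix x y :: real assume xy: "x \<in> {a..<b}" "x < y"
    define h where "h = min m (y - x)"
    have "dist (u (x + h)) (u x) \<le> 2 * M / m * (x + h - x)"
      using incr[of x h] xy m(1) by (simp add: h_def)
    then show "\<exists>z\<in>{x<..y}. dist (u z) (u x) \<le> 2 * M / m * (z - x)"
      using xy m(1) by (intro bexI[of _ "x + h"]) (auto simp: h_def)
  qed (use m continuous_on_flow[OF assms] in \<open>auto simp: M_def\<close>)
  then show ?thesis by (rule that)
qed

lemma abs_velocity_le:
  assumes "C-lipschitz_on {a..b} u" "a < t" "t < b" "0 < t" "t \<notin> N"
  shows "\<bar>velocity u t v\<bar> \<le> C * norm v"
proof (rule tendsto_upperbound)
  show "((\<lambda>s. \<bar>(u s \<bullet> v - u t \<bullet> v) / (s - t)\<bar>) \<longlongrightarrow> \<bar>velocity u t v\<bar>) (at t)"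
    using has_derivative_inner[OF assms(4,5), of v]
    by (intro tendsto_rabs) (simp add: has_field_derivative_iff)
  have "\<forall>\<^sub>F s in at t. s \<in> {a<..<b}"
    using assms by (intro eventually_at_in_open') auto
  then show "\<forall>\<^sub>F s in at t. \<bar>(u s \<bullet> v - u t \<bullet> v) / (s - t)\<bar> \<le> C * norm v"
  proof eventually_elim
    case (elim s)
    have "\<bar>u s \<bullet> v - u t \<bullet> v\<bar> \<le> norm (u s - u t) * norm v"
      by (metis Cauchy_Schwarz_ineq2 inner_diff_left)
    also have "\<dots> \<le> (C * \<bar>s - t\<bar>) * norm v"
      using lipschitz_onD[OF assms(1), of s t] elim assms(2,3)
      by (intro mult_right_mono) (auto simp: dist_norm)
    finally show ?case
      using lipschitz_on_nonneg[OF assms(1)]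
      by (cases "s = t") (auto simp: abs_divide field_simps)
  qed
qed simp

text \<open>Testing the inequality at each of two good times with the position at the other bounds
  the energy difference from both sides. The velocity term is controlled by the Lipschitz constant
  of \<open>u\<close>, and the quadratic term by the square of the distance.\<close>

lemma lipschitz_\<phi>:
  assumes "0 < a"
  obtains K where "K-lipschitz_on ({a..b} - N) \<phi>"
proof -
  \<comment> \<open>The interval is enlarged so that every time in \<open>{a..b}\<close> is
    interior, as the bound on the velocity requires.\<close>
  obtain C where C: "C-lipschitz_on {a / 2..b + 1} u"
    using lipschitz_flow[of "a / 2"] assms by auto
  have "0 \<le> C" by (rule lipschitz_on_nonneg[OF C])
  define K where "K = C * C + \<bar>l / 2\<bar> * (C * (C * \<bar>b - a\<bar>))"
  have le: "\<phi> t - \<phi> s \<le> K * \<bar>t - s\<bar>" if ts: "t \<in> {a..b} - N" "s \<in> {a..b} - N" for t s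
  proof -
    define \<Delta> where "\<Delta> = norm (u t - u s)"
    have \<Delta>: "\<Delta> \<le> C * \<bar>t - s\<bar>" "0 \<le> \<Delta>"
      using lipschitz_onD[OF C, of t s] ts assms by (auto simp: \<Delta>_def dist_norm)
    have "\<bar>velocity u t (u t - u s)\<bar> \<le> C * \<Delta>"
      unfolding \<Delta>_def using ts assms by (intro abs_velocity_le[OF C]) auto
    moreover have "C * \<Delta> \<le> C * (C * \<bar>t - s\<bar>)"
      using \<Delta> \<open>0 \<le> C\<close> by (intro mult_left_mono)
    moreover have "- (l / 2 * \<Delta>\<^sup>2) \<le> \<bar>l / 2\<bar> * \<Delta>\<^sup>2"
      by (metis abs_ge_minus_self abs_mult abs_power2)
    moreover have "\<bar>l / 2\<bar> * \<Delta>\<^sup>2 \<le> \<bar>l / 2\<bar> * ((C * \<bar>t - s\<bar>) * (C * \<bar>b - a\<bar>))"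
    proof (intro mult_left_mono)
      have "C * \<bar>t - s\<bar> \<le> C * \<bar>b - a\<bar>" using ts \<open>0 \<le> C\<close> by (intro mult_left_mono) auto
      then show "\<Delta>\<^sup>2 \<le> (C * \<bar>t - s\<bar>) * (C * \<bar>b - a\<bar>)"
        unfolding power2_eq_square using \<Delta> \<open>0 \<le> C\<close> by (intro mult_mono) auto
    qed simp
    moreover have "velocity u t (u t - u s) + l / 2 * \<Delta>\<^sup>2 + \<phi> t \<le> \<phi> s"
      unfolding \<Delta>_def using ts assms by (intro evi_velocity_flow) auto
    ultimately have "\<phi> t - \<phi> s
        \<le> C * (C * \<bar>t - s\<bar>) + \<bar>l / 2\<bar> * ((C * \<bar>t - s\<bar>) * (C * \<bar>b - a\<bar>))"
      by linarith
    then show ?thesis by (simp add: K_def algebra_simps)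
  qed
  have "K-lipschitz_on ({a..b} - N) \<phi>"
  proof (rule lipschitz_onI)
    fix t s assume "t \<in> {a..b} - N" "s \<in> {a..b} - N"
    then show "dist (\<phi> t) (\<phi> s) \<le> K * dist t s"
      using le[of t s] le[of s t] by (simp add: dist_real_def abs_le_iff abs_minus_commute)
  qed (use \<open>0 \<le> C\<close> in \<open>simp add: K_def\<close>)
  then show ?thesis by (rule that)
qed

section \<open>Density of good times and backward limits\<close>

lemma good_time_between:
  assumes "c < d"
  obtains t where "c < t" "t < d" "t \<notin> N"
proof -
  have "\<not> {c<..<d} \<subseteq> N"
  proof
    assume "{c<..<d} \<subseteq> N"
    then have "{c<..<d} \<in> null_sets lborel" by (intro null_sets_subset[OF null]) simp_all
    then show False using assms by (simp add: null_sets_def)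
  qed
  then show ?thesis using that by (meson greaterThanLessThan_iff subsetI)
qed

lemma Icc_subset_closure:
  assumes "a < b"
  shows "{a..b} \<subseteq> closure ({a..b} - N)"
proof
  fix x assume x: "x \<in> {a..b}"
  show "x \<in> closure ({a..b} - N)"
    unfolding closure_approachable
  proof (intro allI impI)
    fix e :: real assume "e > 0"
    then have "max a (x - e) < min b (x + e)" using x assms by auto
    from good_time_between[OF this]
    obtain y where "max a (x - e) < y" "y < min b (x + e)" "y \<notin> N" .
    then show "\<exists>y\<in>{a..b} - N. dist y x < e"
      by (intro bexI[of _ y]) (auto simp: dist_real_def)
  qed
qed

text \<open>Steps are restricted to those leading back to a time outside \<open>N\<close>, because
  the energy at \<open>t - k\<close> is compared through \<open>\<phi>\<close>.\<close>

definition backward :: "real \<Rightarrow> real filter" where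
  "backward t = at 0 within {k. 0 < k \<and> t - k \<notin> N}"

lemma backward_neq_bot: "backward t \<noteq> bot"
proof -
  have "0 islimpt {k. 0 < k \<and> t - k \<notin> N}"
    unfolding islimpt_approachable
  proof (intro allI impI)
    fix e :: real assume "e > 0"
    then have "t - e < t" by simp
    from good_time_between[OF this] obtain s where "t - e < s" "s < t" "s \<notin> N" by blast
    then show "\<exists>k\<in>{k. 0 < k \<and> t - k \<notin> N}. k \<noteq> 0 \<and> dist k 0 < e"
      by (intro bexI[of _ "t - s"]) (auto simp: dist_real_def)
  qed
  then show ?thesis unfolding backward_def using trivial_limit_within by blast
qed

lemma eventually_backward: "\<forall>\<^sub>F k in backward t. 0 < k \<and> t - k \<notin> N"
  unfolding backward_def eventually_at_filter by simp

lemma eventually_backward_less: "0 < \<eta> \<Longrightarrow> \<forall>\<^sub>F k in backward t. k < \<eta>"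
  unfolding backward_def eventually_at by (auto simp: dist_real_def intro!: exI[of _ \<eta>])

lemma backward_quotient:
  fixes f :: "real \<Rightarrow> real"
  assumes "(f has_real_derivative D) (at t)"
  shows "((\<lambda>k. (f t - f (t - k)) / k) \<longlongrightarrow> D) (backward t)"
proof -
  have "((\<lambda>k. f (t - k)) has_real_derivative D * (0 - 1)) (at 0)"
    using assms by (intro DERIV_chain2[where f = f and g = "\<lambda>k. t - k"] DERIV_diff DERIV_const DERIV_ident) simp
  then have "((\<lambda>k. - ((f (t - k) - f t) / k)) \<longlongrightarrow> - (D * (0 - 1))) (at 0)"
    by (intro tendsto_minus) (simp add: has_field_derivative_iff)
  then have "((\<lambda>k. (f t - f (t - k)) / k) \<longlongrightarrow> D) (at 0)"
    by (simp add: minus_divide_left)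
  then show ?thesis unfolding backward_def by (rule tendsto_within_subset) simp
qed

text \<open>The backward difference quotients are bounded by the Lipschitz constant and converge
  weakly to the velocity, so the convex hull argument applies to them; the result is multiplied by
  \<open>k\<close>.\<close>

lemma frequently_velocity_ge:
  assumes "0 < t" "t \<notin> N" "0 < \<epsilon>"
  shows "\<exists>\<^sub>F k in backward t.
    k * (2 * velocity u t w - (norm w)\<^sup>2 - \<epsilon>) \<le> velocity u t (u t - u (t - k))"
proof -
  define e where "e k = (1 / k) *\<^sub>R (u t - u (t - k))" for k
  interpret L: linear "velocity u t" by (rule linear_velocity[OF assms(1,2)])
  obtain C where C: "C-lipschitz_on {t / 2..t} u"
    using lipschitz_flow[of "t / 2"] assms by auto
  have "\<exists>\<^sub>F k in backward t. velocity u t (e k) \<ge> 2 * velocity u t w - (norm w)\<^sup>2 - \<epsilon>"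
  proof (rule frequently_weak_limit_ge[OF backward_neq_bot])
    fix v
    have "(\<lambda>k. e k \<bullet> v) = (\<lambda>k. (u t \<bullet> v - u (t - k) \<bullet> v) / k)"
      by (auto simp: e_def inner_diff_left)
    then show "((\<lambda>k. e k \<bullet> v) \<longlongrightarrow> velocity u t v) (backward t)"
      using backward_quotient[OF has_derivative_inner[OF assms(1,2), of v]] by simp
  next
    show "\<forall>\<^sub>F k in backward t. norm (e k) \<le> C"
      using eventually_backward[of t] eventually_backward_less[OF half_gt_zero[OF assms(1)], of t]
    proof eventually_elim
      case (elim k)
      then have "norm (u t - u (t - k)) \<le> C * k"
        using lipschitz_onD[OF C, of t "t - k"] assms by (simp add: dist_norm)
      then show ?case using elim by (simp add: e_def pos_divide_le_eq del: scaleR_right_diff_distrib)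
    qed
  qed (use assms L.linear_axioms in auto)
  then show ?thesis
  proof (rule frequently_rev_mp)
    show "\<forall>\<^sub>F k in backward t. 2 * velocity u t w - (norm w)\<^sup>2 - \<epsilon> \<le> velocity u t (e k) \<longrightarrow>
        k * (2 * velocity u t w - (norm w)\<^sup>2 - \<epsilon>) \<le> velocity u t (u t - u (t - k))"
      using eventually_backward[of t]
      by eventually_elim (simp add: e_def L.scale pos_le_divide_eq mult.commute)
  qed
qed

text \<open>
  Inequality \<open>ineq\<close> says that \<open>K * (\<phi> - r) + g * \<parallel>u - v\<parallel>\<^sup>2\<close> has nonpositive derivative
  if \<open>\<phi>\<close> has the derivative \<open>- \<parallel>L\<parallel>\<^sup>2\<close> with \<open>L = velocity u t\<close>; the right-hand side comes from
  \<open>- \<parallel>L\<parallel>\<^sup>2 \<le> \<parallel>w\<parallel>\<^sup>2 - 2 L w\<close> for \<open>w = c (u t - v)\<close>.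
\<close>

lemma weighted_energy_le:
  fixes K K' g g' :: "real \<Rightarrow> real"
  assumes \<tau>: "0 < \<tau>" "\<tau> < T" and T: "T \<notin> N"
    and K: "\<And>t. (K has_real_derivative K' t) (at t)" "continuous_on {\<tau>..T} K'"
      "K \<tau> = 0" "\<And>t. \<tau> \<le> t \<Longrightarrow> 0 \<le> K t"
    and g: "\<And>t. (g has_real_derivative g' t) (at t)" "continuous_on {\<tau>..T} g'"
    and ineq: "\<And>t. \<tau> < t \<Longrightarrow> t \<le> T \<Longrightarrow> t \<notin> N \<Longrightarrow>
      K' t * (\<phi> t - r) + (g' t * (norm (u t - v))\<^sup>2 + 2 * velocity u t (u t - v) * g t)
        \<le> K t * (2 * c * velocity u t (u t - v) - c\<^sup>2 * (norm (u t - v))\<^sup>2)"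
  shows "K T * (\<phi> T - r) + g T * (norm (u T - v))\<^sup>2 \<le> g \<tau> * (norm (u \<tau> - v))\<^sup>2"
proof -
  obtain M where "M-lipschitz_on ({\<tau>..T} - N) \<phi>"
    by (rule lipschitz_\<phi>[OF \<tau>(1)])
  \<comment> \<open>On \<open>N\<close> the function \<open>\<phi>\<close> is uncontrolled. It is
    replaced by a Lipschitz extension \<open>p\<close> from the good times, which agrees with it at
    the good endpoint \<open>T\<close>.\<close>
  then obtain p where p: "M-lipschitz_on (closure ({\<tau>..T} - N)) p" "\<And>t. t \<in> {\<tau>..T} - N \<Longrightarrow> p t = \<phi> t"
    using lipschitz_extend_closure by blast
  have p_lip: "M-lipschitz_on {\<tau>..T} p"
    using p(1) Icc_subset_closure[OF \<tau>(2)] by (rule lipschitz_on_subset)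
  obtain C where C: "C-lipschitz_on {\<tau>..T} u"
    by (rule lipschitz_flow[OF \<tau>(1)])
  define F where "F t = K t * (p t - r) + g t * (norm (u t - v))\<^sup>2" for t
  have "abs_continuous_on {\<tau>..T} F"
    unfolding F_def power2_eq_square[of "norm _"]
    using lac \<tau>
    by (intro abs_continuous_on_add abs_continuous_on_mult abs_continuous_on_diff
        abs_continuous_on_norm abs_continuous_on_const C1_imp_abs_continuous_on[OF K(1,2)]
        C1_imp_abs_continuous_on[OF g] lipschitz_on_imp_abs_continuous_on[OF p_lip])
      (simp_all add: locally_abs_continuous_def)
  then have "F T \<le> F \<tau>"
  proof (rule abs_continuous_on_Dini_le[OF _ less_imp_le[OF \<tau>(2)] null])
    fix t \<epsilon> \<eta> :: real
    assume t: "\<tau> < t" "t \<le> T" "t \<notin> N" and "\<epsilon> > 0" "\<eta> > 0"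
    have "0 < t" using t \<tau> by simp
    have pt: "p t = \<phi> t" using t by (intro p(2)) auto
    define w where "w = u t - v"
    define L where "L = velocity u t"
    interpret L: linear L unfolding L_def by (rule linear_velocity[OF \<open>0 < t\<close> t(3)])
    define m where "m = 2 * L (c *\<^sub>R w) - (norm (c *\<^sub>R w))\<^sup>2"
    have "0 \<le> K t" using K(4) t by simp
    \<comment> \<open>\<open>\<epsilon>1\<close> is spent twice, on the velocity estimate and on the
      quadratic term. Together, weighted by \<open>K t\<close>, they cost a quarter of \<epsilon>;
      two more quarters go to the quotient of \<open>R\<close> and to the continuity of
      \<open>K\<close>.\<close>
    define \<epsilon>1 where "\<epsilon>1 = \<epsilon> / (8 * (K t + 1))"
    have "\<epsilon>1 > 0" using \<open>\<epsilon> > 0\<close> \<open>0 \<le> K t\<close> by (simp add: \<epsilon>1_def)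
    have \<epsilon>1: "K t * (2 * \<epsilon>1) \<le> \<epsilon> / 4"
      using \<open>\<epsilon> > 0\<close> \<open>0 \<le> K t\<close> by (simp add: \<epsilon>1_def field_simps)
    \<comment> \<open>Freezing the energy at its value at \<open>t\<close> makes \<open>R\<close>
      differentiable. The increment of \<open>F\<close> is that of \<open>R\<close> plus
      \<open>K (t - k)\<close> times the energy increment, which is estimated through the inequality
      tested with \<open>u (t - k)\<close>.\<close>
    define R where "R s = K s * (p t - r) + g s * (norm (u s - v))\<^sup>2" for s
    define R' where "R' = K' t * (p t - r) + (g' t * (norm w)\<^sup>2 + 2 * L w * g t)"
    have "(R has_real_derivative R') (at t)"
      unfolding R_def R'_def w_def L_def
      by (intro DERIV_add DERIV_cmult_right K(1) DERIV_mult g(1)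
          has_derivative_norm_diff_sq[OF \<open>0 < t\<close> t(3)])
    have m: "m = 2 * c * L w - c\<^sup>2 * (norm w)\<^sup>2"
      by (simp add: m_def L.scale power_mult_distrib)
    have "R' \<le> K t * m"
      using ineq[OF t] unfolding R'_def m by (simp add: w_def L_def pt)
    have "\<forall>\<^sub>F k in backward t. (R t - R (t - k)) / k < R' + \<epsilon> / 4"
      using backward_quotient[OF \<open>(R has_real_derivative R') (at t)\<close>] \<open>\<epsilon> > 0\<close>
      by (elim order_tendstoD) simp
    moreover have "((\<lambda>k. K (t - k) * (2 * \<epsilon>1 - m)) \<longlongrightarrow> K (t - 0) * (2 * \<epsilon>1 - m)) (backward t)"
    proof -
      have "isCont K (t - 0)" using K(1) DERIV_isCont by blast
      then show ?thesis
        unfolding backward_def by (intro tendsto_intros isCont_tendsto_compose[of _ K])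
    qed
    then have "\<forall>\<^sub>F k in backward t. K (t - k) * (2 * \<epsilon>1 - m) < K t * (2 * \<epsilon>1 - m) + \<epsilon> / 4"
      using \<open>\<epsilon> > 0\<close> by (elim order_tendstoD) simp
    moreover have "\<forall>\<^sub>F k in backward t. k < \<epsilon>1 / (\<bar>l / 2\<bar> * C\<^sup>2 + 1)"
      using \<open>\<epsilon>1 > 0\<close> by (intro eventually_backward_less divide_pos_pos add_nonneg_pos) auto
    moreover have "\<forall>\<^sub>F k in backward t. k < \<eta>" "\<forall>\<^sub>F k in backward t. k < t - \<tau>"
      using \<open>\<eta> > 0\<close> t by (auto intro: eventually_backward_less)
    ultimately have "\<forall>\<^sub>F k in backward t. k * (2 * L (c *\<^sub>R w) - (norm (c *\<^sub>R w))\<^sup>2 - \<epsilon>1) \<le> L (u t - u (t - k))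
        \<longrightarrow> 0 < k \<and> k < \<eta> \<and> F t - F (t - k) \<le> \<epsilon> * k"
      using eventually_backward[of t]
    proof eventually_elim
      case (elim k)
      then have k: "0 < k" "t - k \<in> {\<tau>..T} - N" "0 < t - k" using t \<tau> by auto
      show ?case
      proof (intro impI conjI)
        assume "k * (2 * L (c *\<^sub>R w) - (norm (c *\<^sub>R w))\<^sup>2 - \<epsilon>1) \<le> L (u t - u (t - k))"
        then have 1: "- L (u t - u (t - k)) \<le> k * (\<epsilon>1 - m)" by (simp add: m_def algebra_simps)
        have "dist (u t) (u (t - k)) \<le> C * dist t (t - k)"
          using k t by (intro lipschitz_onD[OF C]) auto
        then have "norm (u t - u (t - k)) \<le> C * k" using k by (simp add: dist_norm)
        then have "(norm (u t - u (t - k)))\<^sup>2 \<le> (C * k)\<^sup>2" by (intro power_mono) auto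
        then have "\<bar>l / 2\<bar> * (norm (u t - u (t - k)))\<^sup>2 \<le> \<bar>l / 2\<bar> * (C * k)\<^sup>2"
          by (rule mult_left_mono) simp
        also have "\<dots> = k * (k * (\<bar>l / 2\<bar> * C\<^sup>2))" by (simp add: power2_eq_square)
        also have "\<dots> \<le> k * (k * (\<bar>l / 2\<bar> * C\<^sup>2 + 1))"
          using k by (intro mult_left_mono) auto
        also have "k * (\<bar>l / 2\<bar> * C\<^sup>2 + 1) \<le> \<epsilon>1"
          using elim by (simp add: pos_less_divide_eq add_nonneg_pos)
        finally have "\<bar>l / 2\<bar> * (norm (u t - u (t - k)))\<^sup>2 \<le> k * \<epsilon>1" using k by simp
        moreover have "- (l / 2 * (norm (u t - u (t - k)))\<^sup>2) \<le> \<bar>l / 2\<bar> * (norm (u t - u (t - k)))\<^sup>2"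
          by (metis abs_ge_minus_self abs_mult abs_power2)
        moreover have "L (u t - u (t - k)) + l / 2 * (norm (u t - u (t - k)))\<^sup>2 + \<phi> t \<le> \<phi> (t - k)"
          unfolding L_def using t k \<open>0 < t\<close> by (intro evi_velocity_flow) auto
        ultimately have "p t - p (t - k) \<le> k * (2 * \<epsilon>1 - m)"
          using 1 pt p(2)[OF k(2)] by (simp add: algebra_simps)
        then have "K (t - k) * (p t - p (t - k)) \<le> K (t - k) * (k * (2 * \<epsilon>1 - m))"
          using K(4) k by (intro mult_left_mono) auto
        also have "\<dots> = k * (K (t - k) * (2 * \<epsilon>1 - m))" by (simp add: algebra_simps)
        also have "\<dots> \<le> k * (K t * (2 * \<epsilon>1 - m) + \<epsilon> / 4)"
          using elim k by (intro mult_left_mono) auto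
        finally have 2: "K (t - k) * (p t - p (t - k)) \<le> k * (K t * (2 * \<epsilon>1 - m) + \<epsilon> / 4)" .
        have "R t - R (t - k) \<le> k * (R' + \<epsilon> / 4)"
          using elim k by (simp add: pos_divide_less_eq mult.commute)
        moreover have "F t - F (t - k) = R t - R (t - k) + K (t - k) * (p t - p (t - k))"
          by (simp add: F_def R_def algebra_simps)
        ultimately have "F t - F (t - k) \<le> k * (R' + \<epsilon> / 4 + (K t * (2 * \<epsilon>1 - m) + \<epsilon> / 4))"
          using 2 by (simp add: distrib_left)
        also have "\<dots> \<le> k * \<epsilon>"
          using k \<epsilon>1 \<open>R' \<le> K t * m\<close> \<open>\<epsilon> > 0\<close> by (intro mult_left_mono) (auto simp: right_diff_distrib)
        finally show "F t - F (t - k) \<le> \<epsilon> * k" by (simp add: mult.commute)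
      qed (use elim in auto)
    qed
    then have "\<exists>\<^sub>F k in backward t. 0 < k \<and> k < \<eta> \<and> F t - F (t - k) \<le> \<epsilon> * k"
      using frequently_velocity_ge[OF \<open>0 < t\<close> t(3) \<open>\<epsilon>1 > 0\<close>, of "c *\<^sub>R w"]
      unfolding L_def by (rule frequently_rev_mp[rotated])
    then show "\<exists>k. 0 < k \<and> k < \<eta> \<and> F t - F (t - k) \<le> \<epsilon> * k"
      by (rule frequently_ex)
  qed
  then show ?thesis using K(3) p(2)[of T] T \<tau> by (simp add: F_def)
qed

section \<open>Energy bounds at good times and at all times\<close>

text \<open>The clock starts at a positive \<tau> because the regularity estimates hold only away
  from time 0. The weight \<open>K\<close> vanishes at \<tau>, which removes the initial energy, and
  \<open>E = 1 + 2 * l * K\<close> is its derivative.\<close>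

lemma energy_le_good:
  assumes \<tau>: "0 < \<tau>" "\<tau> < T" and T: "T \<notin> N" and v: "\<Phi> v = ereal r"
  shows "\<phi> T \<le> r + 1 / (2 * kappa (T - \<tau>) l) * (norm (u \<tau> - v))\<^sup>2"
proof -
  define K where "K t = kappa (t - \<tau>) l" for t
  define E where "E t = exp (2 * l * (t - \<tau>))" for t
  have K: "(K has_real_derivative E t) (at t)" for t
    using DERIV_chain2[OF has_derivative_kappa DERIV_diff[OF DERIV_ident DERIV_const]]
    unfolding K_def E_def by simp
  have E: "(E has_real_derivative 2 * l * E t) (at t)" for t
    unfolding E_def by (auto intro!: derivative_eq_intros)
  have cont_E: "continuous_on {\<tau>..T} E"
    unfolding E_def by (intro continuous_intros)
  have K_nonneg: "0 \<le> K t" if "\<tau> \<le> t" for t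
    using that kappa_pos[of "t - \<tau>" l] by (cases "t = \<tau>") (auto simp: K_def)
  have E_K: "E t = 1 + 2 * l * K t" for t unfolding E_def K_def by (rule exp_eq_kappa)
  have evi': "E t * (\<phi> t - r) \<le> E t * (- velocity u t (u t - v) - l / 2 * (norm (u t - v))\<^sup>2)"
    if "\<tau> < t" "t \<notin> N" for t
    using evi_velocity[of t v r] that \<tau> v by (intro mult_left_mono) (auto simp: E_def)
  have "K T * (\<phi> T - r) \<le> 1 / 2 * (norm (u \<tau> - v))\<^sup>2"
  proof (cases "0 \<le> l")
    case True
    have "K T * (\<phi> T - r) + 1 / 2 * (norm (u T - v))\<^sup>2 \<le> 1 / 2 * (norm (u \<tau> - v))\<^sup>2"
    \<comment> \<open>With \<open>c = - l\<close> the right-hand side absorbs the terms carrying the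
      factor \<open>K\<close>; what remains is \<open>- l / 2\<close> times the squared distance,
      nonpositive here.\<close>
    proof (rule weighted_energy_le[OF \<tau> T K cont_E, where c = "- l" and g = "\<lambda>_. 1 / 2" and g' = "\<lambda>_. 0"])
      fix t assume t: "\<tau> < t" "t \<notin> N"
      have "0 \<le> l * (norm (u t - v))\<^sup>2" using True by simp
      then show "E t * (\<phi> t - r) + (0 * (norm (u t - v))\<^sup>2 + 2 * velocity u t (u t - v) * (1 / 2))
          \<le> K t * (2 * - l * velocity u t (u t - v) - (- l)\<^sup>2 * (norm (u t - v))\<^sup>2)"
        using evi'[OF t] unfolding E_K
        by (simp add: algebra_simps add_divide_distrib power2_eq_square[of l])
    qed (auto simp: K_def intro: K_nonneg[unfolded K_def])
    moreover have "0 \<le> 1 / 2 * (norm (u T - v))\<^sup>2" by simp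
    ultimately show ?thesis by linarith
  next
    case False
    have "K T * (\<phi> T - r) + E T / 2 * (norm (u T - v))\<^sup>2 \<le> E \<tau> / 2 * (norm (u \<tau> - v))\<^sup>2"
    \<comment> \<open>With the weight \<open>E / 2\<close> on the squared distance the velocity
      terms cancel, leaving \<open>l * E / 2\<close> times the squared distance, again
      nonpositive.\<close>
    proof (rule weighted_energy_le[OF \<tau> T K cont_E, where c = 0 and g' = "\<lambda>t. l * E t"])
      fix t
      show "((\<lambda>t. E t / 2) has_real_derivative l * E t) (at t)"
        using DERIV_cdivide[OF E, of 2 t] by simp
    next
      fix t assume t: "\<tau> < t" "t \<notin> N"
      have "l * (E t * (norm (u t - v))\<^sup>2) \<le> 0"
        using False by (intro mult_nonpos_nonneg) (auto simp: E_def)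
      then show "E t * (\<phi> t - r) + (l * E t * (norm (u t - v))\<^sup>2 + 2 * velocity u t (u t - v) * (E t / 2))
          \<le> K t * (2 * 0 * velocity u t (u t - v) - 0\<^sup>2 * (norm (u t - v))\<^sup>2)"
        using evi'[OF t] by (simp add: algebra_simps)
    qed (auto simp: K_def intro: K_nonneg[unfolded K_def] intro!: continuous_on_mult_left cont_E)
    moreover have "0 \<le> E T / 2 * (norm (u T - v))\<^sup>2" "E \<tau> = 1" by (simp_all add: E_def)
    ultimately show ?thesis by simp
  qed
  moreover have "0 < K T" unfolding K_def using \<tau> by (intro kappa_pos) simp
  ultimately show ?thesis unfolding K_def[symmetric] by (simp add: field_simps)
qed

text \<open>Two limits are taken: \<tau> tends to 0 at a fixed good time, where \<open>u\<close>
  tends to the initial point, and then good times approach an arbitrary \<open>t\<close> from the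
  left, where lower semicontinuity keeps the bound.\<close>

lemma energy_le:
  assumes u0: "(u \<longlongrightarrow> x\<^sub>0) (at_right 0)" and lsc: "lower_semicontinuous \<Phi>"
    and "0 < t" and v: "\<Phi> v = ereal r"
  shows "\<Phi> (u t) \<le> ereal (r + 1 / (2 * kappa t l) * (norm (v - x\<^sub>0))\<^sup>2)"
proof -
  define B where "B s = r + 1 / (2 * kappa s l) * (norm (v - x\<^sub>0))\<^sup>2" for s
  have good: "\<phi> s \<le> B s" if "0 < s" "s \<notin> N" for s
  proof (rule tendsto_lowerbound)
    have pos: "2 * kappa (s - 0) l \<noteq> 0" using kappa_pos[OF \<open>0 < s\<close>, of l] by simp
    have "isCont (\<lambda>t. kappa t l) (s - 0)" using has_derivative_kappa DERIV_isCont by blast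
    then have "((\<lambda>\<tau>. kappa (s - \<tau>) l) \<longlongrightarrow> kappa (s - 0) l) (at_right 0)"
      by (rule isCont_tendsto_compose) (intro tendsto_intros)
    then have "((\<lambda>\<tau>. r + 1 / (2 * kappa (s - \<tau>) l) * (norm (u \<tau> - v))\<^sup>2)
        \<longlongrightarrow> r + 1 / (2 * kappa (s - 0) l) * (norm (x\<^sub>0 - v))\<^sup>2) (at_right 0)"
      using pos by (intro tendsto_intros u0)
    then show "((\<lambda>\<tau>. r + 1 / (2 * kappa (s - \<tau>) l) * (norm (u \<tau> - v))\<^sup>2) \<longlongrightarrow> B s) (at_right 0)"
      by (simp add: B_def norm_minus_commute)
    have "\<forall>\<^sub>F \<tau> in at_right 0. 0 < \<tau> \<and> \<tau> < s"
      using \<open>0 < s\<close> by (auto simp: eventually_at_right_field)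
    then show "\<forall>\<^sub>F \<tau> in at_right 0. \<phi> s \<le> r + 1 / (2 * kappa (s - \<tau>) l) * (norm (u \<tau> - v))\<^sup>2"
      by eventually_elim (use energy_le_good that v in auto)
  qed simp
  have "\<Phi> (u t) \<le> ereal (B t)"
  proof (rule ccontr)
    assume "\<not> \<Phi> (u t) \<le> ereal (B t)"
    then obtain y where y: "ereal (B t) < ereal y" "ereal y < \<Phi> (u t)"
      using ereal_dense2[of "ereal (B t)" "\<Phi> (u t)"] by (auto simp: not_le)
    have "ereal y < Liminf (at (u t)) \<Phi>"
      using y(2) lsc unfolding lower_semicontinuous_def by (meson less_le_trans)
    then have "\<forall>\<^sub>F x in at (u t). ereal y < \<Phi> x" by (rule less_LiminfD)
    \<comment> \<open>The limit inferior ignores the centre, but \<open>u (t - k)\<close> may equal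
      \<open>u t\<close>; the strict inequality at \<open>u t\<close> itself fills the gap.\<close>
    then have ev: "\<forall>\<^sub>F x in nhds (u t). ereal y < \<Phi> x"
      using y(2) by (auto simp: eventually_at_filter elim: eventually_mono)
    have bw: "backward t \<le> at 0" unfolding backward_def by (rule at_le) simp
    have "((\<lambda>k. t - k) \<longlongrightarrow> t - 0) (at 0)" by (intro tendsto_intros)
    then have to_t: "((\<lambda>k. t - k) \<longlongrightarrow> t) (backward t)" using bw by (simp add: tendsto_mono)
    have "isCont u t"
      using continuous_on_flow[of "t / 2" "t + 1"] \<open>0 < t\<close>
      by (intro continuous_on_interior[of "{t / 2..t + 1}"]) auto
    then have "((\<lambda>k. u (t - k)) \<longlongrightarrow> u t) (backward t)"
      using to_t by (rule isCont_tendsto_compose)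
    then have "\<forall>\<^sub>F k in backward t. ereal y < \<Phi> (u (t - k))"
      using ev by (auto simp: filterlim_iff)
    moreover have "isCont B t"
      unfolding B_def using kappa_pos[OF \<open>0 < t\<close>, of l] DERIV_isCont[OF has_derivative_kappa]
      by (intro continuous_intros) auto
    then have "((\<lambda>k. B (t - k)) \<longlongrightarrow> B t) (backward t)"
      using to_t by (rule isCont_tendsto_compose)
    then have "\<forall>\<^sub>F k in backward t. B (t - k) < y"
      using y(1) by (elim order_tendstoD) simp
    moreover have "\<forall>\<^sub>F k in backward t. k < t"
      using \<open>0 < t\<close> by (rule eventually_backward_less)
    ultimately have "\<forall>\<^sub>F k in backward t. False"
      using eventually_backward[of t]
    proof eventually_elim
      case (elim k)
      then have "\<phi> (t - k) \<le> B (t - k)" "ereal (\<phi> (t - k)) = \<Phi> (u (t - k))"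
        by (auto intro: good ereal_\<phi>)
      then have "ereal y < ereal (\<phi> (t - k))" "\<phi> (t - k) < y" using elim by auto
      then show ?case by simp
    qed
    then show False using backward_neq_bot by (simp add: eventually_False)
  qed
  then show ?thesis by (simp add: B_def)
qed

end

section \<open>Application to the gradient flow\<close>

lemma gradient_flow_imp_evi_flow:
  assumes "\<And>x. \<Phi> x \<noteq> -\<infinity>" "proper_fun \<Phi>" "gradient_flow l \<Phi> x\<^sub>0 u"
  obtains N where "evi_flow l \<Phi> u N"
proof -
  obtain N where N: "N \<in> null_sets lborel"
    and evi: "\<And>t v. t > 0 \<Longrightarrow> t \<notin> N \<Longrightarrow>
      \<exists>D. ((\<lambda>s. (norm (u s - v))\<^sup>2) has_real_derivative D) (at t) \<and>
        ereal (1/2 * D + 1/2 * l * (norm (u t - v))\<^sup>2) + \<Phi> (u t) \<le> \<Phi> v"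
    using assms(3) unfolding gradient_flow_def by (auto elim!: AE_E3)
  have "evi_flow l \<Phi> u N"
  proof
    show "locally_abs_continuous u" using assms(3) by (simp add: gradient_flow_def)
    fix t assume t: "t > 0" "t \<notin> N"
    \<comment> \<open>Testing with one point of finite energy forces the energy along the curve to
      be finite at good times.\<close>
    obtain v where "\<Phi> v \<noteq> \<infinity>" using assms(2) by (auto simp: proper_fun_def edom_def)
    then have "\<Phi> (u t) \<noteq> \<infinity>" using evi[OF t, of v] by auto
    then show "\<bar>\<Phi> (u t)\<bar> \<noteq> \<infinity>" using assms(1)[of "u t"] by (cases "\<Phi> (u t)") auto
  qed (use N evi in auto)
  then show ?thesis by (rule that)
qed

theorem theorem3p16:
  fixes \<Phi> :: "'a::{real_inner, complete_space} \<Rightarrow> ereal"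
    and l :: real and x\<^sub>0 :: 'a and u :: "real \<Rightarrow> 'a"
  assumes "\<And>x. \<Phi> x \<noteq> -\<infinity>"
    and "proper_fun \<Phi>"
    and "lambda_convex l \<Phi>"
    and "lower_semicontinuous \<Phi>"
    and "x\<^sub>0 \<in> closure (edom \<Phi>)"
    and "gradient_flow l \<Phi> x\<^sub>0 u"
  shows "\<forall>t>0. \<Phi> (u t) \<le> moreau_envelope \<Phi> (kappa t l) x\<^sub>0"
proof (intro allI impI)
  fix t :: real assume "0 < t"
  obtain N where "evi_flow l \<Phi> u N"
    using gradient_flow_imp_evi_flow[OF assms(1,2,6)] by blast
  then interpret evi_flow l \<Phi> u N .
  have "(u \<longlongrightarrow> x\<^sub>0) (at_right 0)" using assms(6) by (simp add: gradient_flow_def)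
  note le = energy_le[OF this assms(4) \<open>0 < t\<close>]
  show "\<Phi> (u t) \<le> moreau_envelope \<Phi> (kappa t l) x\<^sub>0"
    unfolding moreau_envelope_def
  \<comment> \<open>The energy bound is used for each competitor of finite energy; for the others
    the right-hand side is infinite.\<close>
  proof (rule INF_greatest)
    fix y
    show "\<Phi> (u t) \<le> \<Phi> y + ereal (1 / (2 * kappa t l) * (norm (y - x\<^sub>0))\<^sup>2)"
      using le[of y] assms(1)[of y] by (cases "\<Phi> y") auto
  qed
qed

end
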